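(* Let $K$ be a field of characteristic different from two, let $A=K[x_{i,j},y_{i,j}\,(1\le i<j\le 4),\ z_{i,j,k}\,(1\le i<j<k\le 4)]$ be the polynomial ring in $16$ variables, and let $J=\langle u_{2,3,4},u_{1,3,4},u_{1,2,4},u_{1,2,3},u\rangle\subset A$ be the ideal defined in the context. Then the minimal free resolution of $A/J$ over $A$ is $$\mathbb F_\bullet:\quad 0\rightarrow A^2\xrightarrow{d_3}A^6\xrightarrow{d_2}A^5\xrightarrow{d_1}A,$$ where $$d_1=\begin{bmatrix}u_{2,3,4}&u_{1,3,4}&u_{1,2,4}&u_{1,2,3}&u\end{bmatrix},$$ $$d_2=\begin{bmatrix} v_1 & u_1 & -\delta_1+\delta_2-\delta_3 & 2\Delta(13,14) & -2\Delta(12,14) & -2\Delta(12,13) \\ -v_2 & -u_2 &-2\Delta(23,24) & -\delta_1-\delta_2+\delta_3 & 2\Delta(12,24) & 2 \Delta(12,23) \\ v_3 & u_3 & 2\Delta(23,34) & 2\Delta(13,34) & -\delta_1-\delta_2-\delta_3 & -2\Delta(13,23)\\ v_4 & u_4 &2\Delta(24,34) & 2\Delta(14,34) & -2\Delta(14,24) &\delta_1-\delta_2-\delta_3\\ 0 & 0&-z_{2,3,4} & -z_{1,3,4} & z_{1,2,4} & z_{1,2,3} \end{bmatrix},$$ $$d_3=\begin{bmatrix} b & 2a\\ -2c & -b\\ -v_1& -u_1\\ v_2 & u_2\\ v_3 & u_3\\ -v_4 & -u_4 \end{bmatrix}.$$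
   Context: All variables of $A$ have degree $1$ (in fact $A$ is bigraded with $\deg x_{i,j}=\deg y_{i,j}=(1,0)$, $\deg z_{i,j,k}=(0,1)$); minimality is in the graded sense. Set $x_{j,i}=-x_{i,j}$ and $y_{j,i}=-y_{i,j}$ for $i<j$. For $i\in\{1,2,3,4\}$ let $z_{\hat i}$ denote $z_{j,k,l}$ with $j<k<l$ and $\{j,k,l\}=\{1,2,3,4\}\setminus\{i\}$. Let $\Delta(ij,kl)=x_{i,j}y_{k,l}-x_{k,l}y_{i,j}$, and $\delta_1=\Delta(12,34)$, $\delta_2=\Delta(13,24)$, $\delta_3=\Delta(14,23)$. For $1\le j\le4$ put $$u_j=\sum_{i\ne j}(-1)^i x_{i,j}z_{\hat i},\qquad v_j=\sum_{i\ne j}(-1)^i y_{i,j}z_{\hat i}.$$ Put \begin{align*} u_{1,2,3}&=-2z_{2,3,4}\Delta(12,13)+2z_{1,3,4}\Delta(12,23)-2z_{1,2,4}\Delta(13,23)+z_{1,2,3}(\delta_2-\delta_1+\delta_3),\\ u_{1,2,4}&=2z_{2,3,4}\Delta(12,14)-2z_{1,3,4}\Delta(12,24)+z_{1,2,4}(\delta_1+\delta_2+\delta_3)-2z_{1,2,3}\Delta(14,24),\\ u_{1,3,4}&=2z_{2,3,4}\Delta(13,14)+z_{1,3,4}(-\delta_1-\delta_2+\delta_3)+2z_{1,2,4}\Delta(13,34)-2z_{1,2,3}\Delta(14,34),\\ u_{2,3,4}&=z_{2,3,4}(-\delta_1+\delta_2-\delta_3)-2z_{1,3,4}\Delta(23,24)+2z_{1,2,4}\Delta(23,34)-2z_{1,2,3}\Delta(24,34),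 \end{align*} \begin{align*} a&=x_{1,2}x_{3,4}-x_{1,3}x_{2,4}+x_{1,4}x_{2,3},\\ b&=x_{1,2}y_{3,4}-x_{1,3}y_{2,4}+x_{1,4}y_{2,3}+x_{3,4}y_{1,2}-x_{2,4}y_{1,3}+x_{2,3}y_{1,4},\\ c&=y_{1,2}y_{3,4}-y_{1,3}y_{2,4}+y_{1,4}y_{2,3}, \end{align*} and $u=b^2-4ac$. Matrices act on column vectors. *)

theory Defs
  imports
    "HOL-Library.Poly_Mapping"
    "HOL-Computational_Algebra.Computational_Algebra"
    "Jordan_Normal_Form.Matrix_Kernel"
begin

section \<open>Polynomial rings and their standard grading\<close>

text \<open>Polynomials over \<open>'k\<close> in the variables \<open>'v\<close>, as finitely supported functions from
  monomials to coefficients with the convolution product of \<^theory>\<open>HOL-Library.Poly_Mapping\<close>.\<close>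

type_synonym ('v, 'k) mpoly = "('v \<Rightarrow>\<^sub>0 nat) \<Rightarrow>\<^sub>0 'k"

definition Var :: "'v \<Rightarrow> ('v, 'k::comm_ring_1) mpoly" where
  "Var t = Poly_Mapping.single (Poly_Mapping.single t 1) 1"

definition mon_degree :: "('v \<Rightarrow>\<^sub>0 nat) \<Rightarrow> nat" where
  "mon_degree m = (\<Sum>t\<in>Poly_Mapping.keys m. Poly_Mapping.lookup m t)"

text \<open>The zero polynomial is homogeneous of every degree, and a polynomial that is homogeneous
  of negative degree is zero.\<close>

definition homogeneous :: "int \<Rightarrow> ('v, 'k::comm_ring_1) mpoly \<Rightarrow> bool" where
  "homogeneous d p \<longleftrightarrow> (\<forall>m\<in>Poly_Mapping.keys p. int (mon_degree m) = d)"

definition ideal_generated :: "'a::comm_ring_1 set \<Rightarrow> 'a set" where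
  "ideal_generated S = Modules.module.span (*) S"

definition irrelevant_ideal :: "('v, 'k::comm_ring_1) mpoly set" where
  "irrelevant_ideal = ideal_generated (range Var)"


section \<open>Free resolutions of cyclic modules\<close>

text \<open>A complex \<open>0 \<rightarrow> A^{r n} \<rightarrow> \<dots> \<rightarrow> A^{r 1} \<rightarrow> A^{r 0}\<close> is given by the list \<open>[r 0, \<dots>, r n]\<close> of its
  ranks and the list \<open>[d 1, \<dots>, d n]\<close> of its matrices, which act on column vectors. Thus the entry
  of index \<open>i\<close> in the list of matrices is the map from \<open>A^{r (i+1)}\<close> to \<open>A^{r i}\<close>.\<close>

definition mat_image :: "'a::comm_ring_1 mat \<Rightarrow> 'a vec set" where
  "mat_image M = (\<lambda>w. M *\<^sub>v w) ` carrier_vec (dim_col M)"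

text \<open>The submodule of boundaries in \<open>A^{r i}\<close>; at the left end of the complex the incoming
  map is the one from the zero module.\<close>

definition boundaries :: "nat list \<Rightarrow> 'a::comm_ring_1 mat list \<Rightarrow> nat \<Rightarrow> 'a vec set" where
  "boundaries rs ds i = (if i < length ds then mat_image (ds ! i) else {0\<^sub>v (rs ! i)})"

text \<open>Exactness of \<open>0 \<rightarrow> A^{r n} \<rightarrow> \<dots> \<rightarrow> A^{r 0} \<rightarrow> A/J \<rightarrow> 0\<close> with \<open>r 0 = 1\<close>, where the last map
  is the canonical projection, whose kernel is \<open>J\<close>.\<close>

definition free_resolution_quot ::
  "'a::comm_ring_1 set \<Rightarrow> nat list \<Rightarrow> 'a mat list \<Rightarrow> bool" where
  "free_resolution_quot J rs ds \<longleftrightarrow>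
     length rs = Suc (length ds) \<and> rs ! 0 = 1 \<and>
     (\<forall>i<length ds. ds ! i \<in> carrier_mat (rs ! i) (rs ! Suc i)) \<and>
     {w \<in> carrier_vec 1. w $ 0 \<in> J} = boundaries rs ds 0 \<and>
     (\<forall>i<length ds. mat_kernel (ds ! i) = boundaries rs ds (Suc i))"

text \<open>Here \<open>s i q\<close> is the degree of the \<open>q\<close>-th basis vector of the \<open>i\<close>-th free module, that is,
  this module is \<open>\<Oplus>\<^sub>q A(- s i q)\<close>; the matrices are required to be homogeneous of degree zero.\<close>

definition graded_complex ::
  "(nat \<Rightarrow> nat \<Rightarrow> int) \<Rightarrow> nat list \<Rightarrow> ('v, 'k::comm_ring_1) mpoly mat list \<Rightarrow> bool" where
  "graded_complex s rs ds \<longleftrightarrow>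
     (\<forall>i<length ds. \<forall>p<rs ! i. \<forall>q<rs ! Suc i.
        homogeneous (s (Suc i) q - s i p) (ds ! i $$ (p, q)))"

text \<open>Minimality: the image of each differential is contained in \<open>\<mm> F\<close>, where \<open>F\<close> is its
  target and \<open>\<mm>\<close> the irrelevant ideal.\<close>

definition minimal_complex ::
  "nat list \<Rightarrow> ('v, 'k::comm_ring_1) mpoly mat list \<Rightarrow> bool" where
  "minimal_complex rs ds \<longleftrightarrow>
     (\<forall>i<length ds. \<forall>w\<in>mat_image (ds ! i). \<forall>p<rs ! i. w $ p \<in> irrelevant_ideal)"

definition minimal_graded_free_resolution_quot ::
  "('v, 'k::comm_ring_1) mpoly set \<Rightarrow> nat list \<Rightarrow> ('v, 'k) mpoly mat list \<Rightarrow> bool" where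
  "minimal_graded_free_resolution_quot J rs ds \<longleftrightarrow>
     free_resolution_quot J rs ds \<and>
     (\<exists>s. s 0 0 = 0 \<and> graded_complex s rs ds) \<and>
     minimal_complex rs ds"


section \<open>The ring in 16 variables and the distinguished polynomials\<close>

datatype var =
    X12 | X13 | X14 | X23 | X24 | X34
  | Y12 | Y13 | Y14 | Y23 | Y24 | Y34
  | Z123 | Z124 | Z134 | Z234

type_synonym 'k A = "(var, 'k) mpoly"

text \<open>The functions \<open>x_up\<close> and \<open>y_up\<close> are supported on \<open>1 \<le> i < j \<le> 4\<close>; antisymmetrizing them
  yields the convention that \<open>x_{j,i} = - x_{i,j}\<close> and \<open>y_{j,i} = - y_{i,j}\<close>.\<close>

definition x_up :: "nat \<Rightarrow> nat \<Rightarrow> 'k::field A" where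
  "x_up i j =
     (if (i, j) = (1, 2) then Var X12
      else if (i, j) = (1, 3) then Var X13
      else if (i, j) = (1, 4) then Var X14
      else if (i, j) = (2, 3) then Var X23
      else if (i, j) = (2, 4) then Var X24
      else if (i, j) = (3, 4) then Var X34
      else 0)"

definition y_up :: "nat \<Rightarrow> nat \<Rightarrow> 'k::field A" where
  "y_up i j =
     (if (i, j) = (1, 2) then Var Y12
      else if (i, j) = (1, 3) then Var Y13
      else if (i, j) = (1, 4) then Var Y14
      else if (i, j) = (2, 3) then Var Y23
      else if (i, j) = (2, 4) then Var Y24
      else if (i, j) = (3, 4) then Var Y34
      else 0)"

definition x_el :: "nat \<Rightarrow> nat \<Rightarrow> 'k::field A" where
  "x_el i j = x_up i j - x_up j i"

definition y_el :: "nat \<Rightarrow> nat \<Rightarrow> 'k::field A" where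
  "y_el i j = y_up i j - y_up j i"

definition z123 :: "'k::field A" where "z123 = Var Z123"
definition z124 :: "'k::field A" where "z124 = Var Z124"
definition z134 :: "'k::field A" where "z134 = Var Z134"
definition z234 :: "'k::field A" where "z234 = Var Z234"

definition z_hat :: "nat \<Rightarrow> 'k::field A" where
  "z_hat i = (if i = 1 then z234 else if i = 2 then z134 else if i = 3 then z124
              else if i = 4 then z123 else 0)"

definition Delta :: "nat \<times> nat \<Rightarrow> nat \<times> nat \<Rightarrow> 'k::field A" where
  "Delta = (\<lambda>(i, j) (k, l). x_el i j * y_el k l - x_el k l * y_el i j)"

definition delta1 :: "'k::field A" where "delta1 = Delta (1,2) (3,4)"
definition delta2 :: "'k::field A" where "delta2 = Delta (1,3) (2,4)"
definition delta3 :: "'k::field A" where "delta3 = Delta (1,4) (2,3)"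

definition u_el :: "nat \<Rightarrow> 'k::field A" where
  "u_el j = (\<Sum>i\<in>{1..4} - {j}. (-1) ^ i * x_el i j * z_hat i)"

definition v_el :: "nat \<Rightarrow> 'k::field A" where
  "v_el j = (\<Sum>i\<in>{1..4} - {j}. (-1) ^ i * y_el i j * z_hat i)"

definition u123 :: "'k::field A" where
  "u123 = - 2 * z234 * Delta (1,2) (1,3) + 2 * z134 * Delta (1,2) (2,3)
          - 2 * z124 * Delta (1,3) (2,3) + z123 * (delta2 - delta1 + delta3)"

definition u124 :: "'k::field A" where
  "u124 = 2 * z234 * Delta (1,2) (1,4) - 2 * z134 * Delta (1,2) (2,4)
          + z124 * (delta1 + delta2 + delta3) - 2 * z123 * Delta (1,4) (2,4)"

definition u134 :: "'k::field A" where
  "u134 = 2 * z234 * Delta (1,3) (1,4) + z134 * (- delta1 - delta2 + delta3)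
          + 2 * z124 * Delta (1,3) (3,4) - 2 * z123 * Delta (1,4) (3,4)"

definition u234 :: "'k::field A" where
  "u234 = z234 * (- delta1 + delta2 - delta3) - 2 * z134 * Delta (2,3) (2,4)
          + 2 * z124 * Delta (2,3) (3,4) - 2 * z123 * Delta (2,4) (3,4)"

definition a_el :: "'k::field A" where
  "a_el = x_el 1 2 * x_el 3 4 - x_el 1 3 * x_el 2 4 + x_el 1 4 * x_el 2 3"

definition b_el :: "'k::field A" where
  "b_el = x_el 1 2 * y_el 3 4 - x_el 1 3 * y_el 2 4 + x_el 1 4 * y_el 2 3
          + x_el 3 4 * y_el 1 2 - x_el 2 4 * y_el 1 3 + x_el 2 3 * y_el 1 4"

definition c_el :: "'k::field A" where
  "c_el = y_el 1 2 * y_el 3 4 - y_el 1 3 * y_el 2 4 + y_el 1 4 * y_el 2 3"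

definition u_disc :: "'k::field A" where
  "u_disc = b_el ^ 2 - 4 * a_el * c_el"

definition J_ideal :: "'k::field A set" where
  "J_ideal = ideal_generated {u234, u134, u124, u123, u_disc}"

definition d1 :: "'k::field A mat" where
  "d1 = mat_of_rows_list 5 [[u234, u134, u124, u123, u_disc]]"

definition d2 :: "'k::field A mat" where
  "d2 = mat_of_rows_list 6
    [[v_el 1, u_el 1, - delta1 + delta2 - delta3, 2 * Delta (1,3) (1,4),
        - 2 * Delta (1,2) (1,4), - 2 * Delta (1,2) (1,3)],
     [- v_el 2, - u_el 2, - 2 * Delta (2,3) (2,4), - delta1 - delta2 + delta3,
        2 * Delta (1,2) (2,4), 2 * Delta (1,2) (2,3)],
     [v_el 3, u_el 3, 2 * Delta (2,3) (3,4), 2 * Delta (1,3) (3,4),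
        - delta1 - delta2 - delta3, - 2 * Delta (1,3) (2,3)],
     [v_el 4, u_el 4, 2 * Delta (2,4) (3,4), 2 * Delta (1,4) (3,4),
        - 2 * Delta (1,4) (2,4), delta1 - delta2 - delta3],
     [0, 0, - z234, - z134, z124, z123]]"

definition d3 :: "'k::field A mat" where
  "d3 = mat_of_rows_list 2
    [[b_el, 2 * a_el],
     [- 2 * c_el, - b_el],
     [- v_el 1, - u_el 1],
     [v_el 2, u_el 2],
     [v_el 3, u_el 3],
     [- v_el 4, - u_el 4]]"

end

theory Submission
  imports Defs
begin

text \<open>
  Multiplication by \<open>u\<close> and by \<open>u\<^sub>1\<^sub>2\<^sub>3\<close> is null homotopic on the complex, and
  \<open>h = u\<^sub>4 v\<^sub>3 - u\<^sub>3 v\<^sub>4\<close> is a maximal minor of \<open>d\<^sub>3\<close>. These three elements form a regular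
  sequence, and this forces exactness. Suppose for instance that \<open>d\<^sub>1 w = 0\<close>. The homotopy for \<open>u\<close>
  gives \<open>u w = d\<^sub>2 t\<close>, and the one for \<open>u\<^sub>1\<^sub>2\<^sub>3\<close> then gives \<open>u\<^sub>1\<^sub>2\<^sub>3 t = d\<^sub>3 s + u r\<close>. Modulo
  \<open>(u, u\<^sub>1\<^sub>2\<^sub>3)\<close> the vector \<open>d\<^sub>3 s\<close>, hence \<open>h s\<close>, vanishes, so that \<open>s = u a + u\<^sub>1\<^sub>2\<^sub>3 b\<close>. Therefore
  \<open>u\<close> divides \<open>u\<^sub>1\<^sub>2\<^sub>3 (t - d\<^sub>3 b)\<close>, thus also \<open>t - d\<^sub>3 b = u y\<close>, and \<open>u w = d\<^sub>2 t = u d\<^sub>2 y\<close>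
  yields \<open>w = d\<^sub>2 y\<close>. Exactness at the other places uses the same division with fewer elements.

  The regularity holds because, for a suitable monomial order, the leading monomials
  \<open>x\<^sub>1\<^sub>2\<^sup>2 y\<^sub>3\<^sub>4\<^sup>2\<close>, \<open>x\<^sub>1\<^sub>3 y\<^sub>1\<^sub>2 z\<^sub>2\<^sub>3\<^sub>4\<close> and \<open>x\<^sub>2\<^sub>4 y\<^sub>2\<^sub>3 z\<^sub>1\<^sub>3\<^sub>4\<^sup>2\<close> of \<open>u\<close>, \<open>u\<^sub>1\<^sub>2\<^sub>3\<close> and \<open>h\<close> are
  pairwise coprime and their coefficients \<open>1\<close>, \<open>2\<close> and \<open>1\<close> are units.
\<close>

section \<open>Regular sequences from coprime leading monomials\<close>

text \<open>An injective homomorphism from monomials to the multiplicative monoid of positive natural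
  numbers is a convenient encoding of a monomial order: totality and well-foundedness are those
  of \<^typ>\<open>nat\<close>.\<close>

locale monomial_order =
  fixes key :: "'m::cancel_comm_monoid_add \<Rightarrow> nat"
  assumes key_add: "key (m + n) = key m * key n"
    and key_pos: "0 < key m"
    and inj_key: "inj key"
begin

definition below :: "nat \<Rightarrow> ('m \<Rightarrow>\<^sub>0 'k::field) \<Rightarrow> bool" where
  "below K p \<longleftrightarrow> (\<forall>n\<in>Poly_Mapping.keys p. key n < K)"

text \<open>The leading coefficient is only asserted to exist: over a field any nonzero one can be
  divided by, so just the monomial is recorded.\<close>

definition lead :: "('m \<Rightarrow>\<^sub>0 'k::field) \<Rightarrow> 'm \<Rightarrow> bool" where
  "lead p m \<longleftrightarrow> (\<exists>c. c \<noteq> 0 \<and> below (key m) (p - Poly_Mapping.single m c))"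

definition mdvd :: "'m \<Rightarrow> 'm \<Rightarrow> bool" where
  "mdvd a b \<longleftrightarrow> (\<exists>c. b = a + c)"

lemma below_exists: "\<exists>K. below K p"
proof
  show "below (Suc (\<Sum>n\<in>Poly_Mapping.keys p. key n)) p"
    by (auto simp: below_def less_Suc_eq_le intro: member_le_sum)
qed

lemma below_add: "below K p \<Longrightarrow> below K q \<Longrightarrow> below K (p + q)"
  unfolding below_def using keys_add[of p q] by auto

lemma below_uminus: "below K p \<Longrightarrow> below K (- p)"
  by (simp add: below_def in_keys_iff)

lemma below_diff: "below K p \<Longrightarrow> below K q \<Longrightarrow> below K (p - q)"
  using below_add[of K p "- q"] below_uminus[of K q] by simp

lemma below_mono: "below K p \<Longrightarrow> K \<le> L \<Longrightarrow> below L p"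
  unfolding below_def by force

lemma below_single: "key m < K \<Longrightarrow> below K (Poly_Mapping.single m c)"
  by (simp add: below_def in_keys_iff lookup_single when_def)

lemma below_mult:
  assumes "below K p" "below L q"
  shows "below (K * L) (p * q)"
proof -
  have "key a * key b < K * L" if "a \<in> Poly_Mapping.keys p" "b \<in> Poly_Mapping.keys q" for a b
    using assms that by (auto simp: below_def intro: mult_strict_mono')
  then show ?thesis
    unfolding below_def using keys_mult[of p q] by (fastforce simp: key_add)
qed

text \<open>Sharper than \<open>below_mult\<close>, which would give only
  \<open>Suc (key m) * L\<close>. Cancelling leading terms needs this exact bound.\<close>

lemma below_mult_single:
  assumes "below L q"
  shows "below (key m * L) (Poly_Mapping.single m c * q)"
proof -
  have "key m * key b < key m * L" if "b \<in> Poly_Mapping.keys q" for b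
    using assms that key_pos by (auto simp: below_def)
  moreover have "Poly_Mapping.keys (Poly_Mapping.single m c) \<subseteq> {m}"
    by simp
  ultimately show ?thesis
    unfolding below_def using keys_mult[of "Poly_Mapping.single m c" q]
    by (fastforce simp: key_add)
qed

lemma lead_exists:
  assumes "p \<noteq> 0"
  shows "\<exists>m. lead p m"
proof -
  define M where "M = Max (key ` Poly_Mapping.keys p)"
  have ne: "Poly_Mapping.keys p \<noteq> {}"
    using assms by simp
  have "M \<in> key ` Poly_Mapping.keys p"
    unfolding M_def by (rule Max_in) (use ne in auto)
  then obtain m where m: "m \<in> Poly_Mapping.keys p" "M = key m"
    by blast
  have le: "key n \<le> key m" if "n \<in> Poly_Mapping.keys p" for n
    using m(2) that unfolding M_def by (metis Max_ge finite_imageI finite_keys imageI)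
  let ?c = "Poly_Mapping.lookup p m"
  have "key n < key m" if "n \<in> Poly_Mapping.keys (p - Poly_Mapping.single m ?c)" for n
  proof -
    from that have "n \<noteq> m" and "n \<in> Poly_Mapping.keys p"
      by (auto simp: in_keys_iff lookup_minus lookup_single when_def split: if_splits)
    then show ?thesis
      using le[of n] inj_key by (metis injD le_neq_implies_less)
  qed
  then show ?thesis
    using m(1) unfolding lead_def below_def
    by (intro exI[of _ m] exI[of _ ?c]) (simp add: in_keys_iff)
qed

lemma lead_unique:
  assumes "lead p m" "lead p n"
  shows "m = n"
proof -
  have *: "key n \<le> key m" if asm: "lead p m" "lead p n" for m n
  proof (rule ccontr)
    assume less: "\<not> key n \<le> key m"
    obtain c where c: "c \<noteq> 0" "below (key m) (p - Poly_Mapping.single m c)"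
      using asm(1) unfolding lead_def by blast
    obtain d where d: "d \<noteq> 0" "below (key n) (p - Poly_Mapping.single n d)"
      using asm(2) unfolding lead_def by blast
    have "Poly_Mapping.lookup p n = d"
      using d by (auto simp: below_def in_keys_iff lookup_minus)
    then have "n \<in> Poly_Mapping.keys (p - Poly_Mapping.single m c)"
      using d(1) less by (auto simp: in_keys_iff lookup_minus lookup_single when_def)
    then show False
      using c(2) less by (auto simp: below_def)
  qed
  show ?thesis
    using *[OF assms] *[OF assms(2,1)] inj_key by (auto dest: injD)
qed

lemma lead_nonzero: "lead p m \<Longrightarrow> p \<noteq> 0"
  unfolding lead_def below_def by (auto simp: in_keys_iff)

lemma lead_key_less: "lead p m \<Longrightarrow> below K p \<Longrightarrow> key m < K"
proof -
  assume "lead p m" and K: "below K p"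
  then obtain c where "c \<noteq> 0" "below (key m) (p - Poly_Mapping.single m c)"
    unfolding lead_def by blast
  then have "m \<in> Poly_Mapping.keys p"
    by (auto simp: below_def in_keys_iff lookup_minus)
  then show "key m < K"
    using K by (simp add: below_def)
qed

lemma lead_mult:
  assumes "lead p m" "lead q n"
  shows "lead (p * q) (m + n)"
proof -
  obtain c d where c: "c \<noteq> 0" "below (key m) (p - Poly_Mapping.single m c)"
    and d: "d \<noteq> 0" "below (key n) (q - Poly_Mapping.single n d)"
    using assms unfolding lead_def by blast
  \<comment> \<open>Each factor is split into leading term plus remainder; the three products on the
    right involve at least one remainder, hence stay strictly below
    \<open>key (m + n)\<close>.\<close>
  have "p * q - Poly_Mapping.single (m + n) (c * d) =
      (p - Poly_Mapping.single m c) * (q - Poly_Mapping.single n d)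
      + Poly_Mapping.single m c * (q - Poly_Mapping.single n d)
      + Poly_Mapping.single n d * (p - Poly_Mapping.single m c)"
    by (simp add: algebra_simps mult_single)
  moreover have "below (key (m + n)) \<dots>"
    using below_mult[OF c(2) d(2)] below_mult_single[OF d(2), of m c]
      below_mult_single[OF c(2), of n d]
    by (simp add: key_add mult.commute below_add)
  ultimately show ?thesis
    unfolding lead_def using c(1) d(1) by (intro exI[of _ "c * d"]) simp
qed

lemma lead_add:
  assumes "lead p m" "below (key m) q"
  shows "lead (p + q) m"
proof -
  obtain c where c: "c \<noteq> 0" "below (key m) (p - Poly_Mapping.single m c)"
    using assms(1) unfolding lead_def by blast
  have "p + q - Poly_Mapping.single m c = (p - Poly_Mapping.single m c) + q"
    by simp
  then show ?thesis
    unfolding lead_def using c(1) below_add[OF c(2) assms(2)] by metis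
qed

lemma lead_below:
  assumes "lead p m" "key m < K"
  shows "below K p"
proof -
  obtain c where "below (key m) (p - Poly_Mapping.single m c)"
    using assms(1) unfolding lead_def by blast
  then have "below K (p - Poly_Mapping.single m c)"
    using assms(2) below_mono by (meson less_imp_le)
  from below_add[OF this below_single[OF assms(2), of c]] show ?thesis
    by simp
qed

text \<open>One step of polynomial division: \<open>single n (d / c) * f\<close> has the same
  leading term as \<open>p\<close>, so the difference drops strictly.\<close>

lemma reduce_lead:
  assumes "lead f a" "lead p (a + n)"
  obtains s where "below (key (a + n)) (p - s * f)"
proof -
  obtain c d where c: "c \<noteq> 0" "below (key a) (f - Poly_Mapping.single a c)"
    and d: "d \<noteq> 0" "below (key (a + n)) (p - Poly_Mapping.single (a + n) d)"
    using assms unfolding lead_def by blast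
  let ?s = "Poly_Mapping.single n (d / c)"
  have "p - ?s * f = (p - Poly_Mapping.single (a + n) d) - ?s * (f - Poly_Mapping.single a c)"
    using c(1) by (simp add: algebra_simps mult_single)
  moreover have "below (key (a + n)) \<dots>"
    using below_mult_single[OF c(2), of n "d / c"] d(2)
    by (simp add: below_diff key_add mult.commute)
  ultimately have "below (key (a + n)) (p - ?s * f)"
    by metis
  then show ?thesis
    using that by blast
qed

text \<open>Buchberger's coprimality criterion for two generators. When the two leading monomials of the
  sum agree, the representation is replaced by one with a smaller first cofactor.\<close>

lemma lead_mem_two_generated:
  assumes f: "lead f a" and g: "lead g b"
    and coprime: "\<And>n. mdvd b (a + n) \<Longrightarrow> mdvd b n"
    and "lead (f * q + g * r) m"
  shows "mdvd a m \<or> mdvd b m"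
proof -
  have "below K q \<Longrightarrow> lead (f * q + g * r) m \<Longrightarrow> ?thesis" for K
  proof (induction K arbitrary: q r rule: less_induct)
    case (less K)
    show ?case
    proof (cases "q = 0 \<or> r = 0")
      case True
      then show ?thesis
      proof
        assume "q = 0"
        then have "r \<noteq> 0"
          using less.prems(2) by (auto dest: lead_nonzero)
        then obtain k where "lead r k"
          using lead_exists by blast
        then show ?thesis
          using lead_mult[OF g, of r k] less.prems(2) \<open>q = 0\<close> lead_unique[of "g * r" "b + k" m]
          by (auto simp: mdvd_def)
      next
        assume "r = 0"
        then have "q \<noteq> 0"
          using less.prems(2) by (auto dest: lead_nonzero)
        then obtain k where "lead q k"
          using lead_exists by blast
        then show ?thesis
          using lead_mult[OF f, of q k] less.prems(2) \<open>r = 0\<close> lead_unique[of "f * q" "a + k" m]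
          by (auto simp: mdvd_def)
      qed
    next
      case False
      then obtain i j where i: "lead q i" and j: "lead r j"
        using lead_exists by blast
      note fi = lead_mult[OF f i] and gj = lead_mult[OF g j]
      consider "key (a + i) < key (b + j)" | "key (b + j) < key (a + i)" | "a + i = b + j"
        using inj_key by (meson injD linorder_less_linear)
      then show ?thesis
      proof cases
        case 1
        then have "lead (f * q + g * r) (b + j)"
          using lead_add[OF gj] lead_below[OF fi] by (simp add: add.commute)
        then show ?thesis
          using less.prems(2) lead_unique unfolding mdvd_def by blast
      next
        case 2
        then have "lead (f * q + g * r) (a + i)"
          using lead_add[OF fi] lead_below[OF gj] by simp
        then show ?thesis
          using less.prems(2) lead_unique unfolding mdvd_def by blast
      next
        case 3
        then have "mdvd b i"
          using coprime[of i] by (auto simp: mdvd_def)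
        then obtain n where n: "i = b + n"
          by (auto simp: mdvd_def)
        obtain s where s: "below (key i) (q - s * g)"
          using reduce_lead[OF g, of q n] i n by metis
        \<comment> \<open>The trivial syzygy of \<open>f\<close> and \<open>g\<close> moves
          \<open>s * f * g\<close> from the first summand to the second; the new first cofactor lies
          below \<open>key i\<close>, which is less than \<open>K\<close>.\<close>
        have "f * q + g * r = f * (q - s * g) + g * (r + s * f)"
          by (simp add: algebra_simps)
        then show ?thesis
          using less.IH[OF lead_key_less[OF i less.prems(1)] s] less.prems(2) by metis
      qed
    qed
  qed
  moreover note below_exists[of q]
  ultimately show ?thesis
    using assms(4) by blast
qed

text \<open>The leading monomial \<open>c + n\<close> of \<open>h * t\<close> is a multiple of a
  leading monomial \<open>a\<close> of \<open>I\<close> that is coprime to \<open>c\<close>, so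
  \<open>a\<close> divides \<open>n\<close> and \<open>t\<close> can be reduced modulo
  \<open>I\<close>. The reduction terminates since the keys decrease.\<close>

lemma regular_modulo:
  assumes h: "lead h c"
    and add: "\<And>p q. p \<in> I \<Longrightarrow> q \<in> I \<Longrightarrow> p + q \<in> I"
    and mult: "\<And>p q. p \<in> I \<Longrightarrow> q * p \<in> I"
    and "0 \<in> I"
    and leads: "\<And>p m. p \<in> I \<Longrightarrow> lead p m \<Longrightarrow>
      \<exists>f\<in>I. \<exists>a. lead f a \<and> mdvd a m \<and> (\<forall>n. mdvd a (c + n) \<longrightarrow> mdvd a n)"
    and "h * t \<in> I"
  shows "t \<in> I"
proof -
  have "below K t \<Longrightarrow> h * t \<in> I \<Longrightarrow> t \<in> I" for K
  proof (induction K arbitrary: t rule: less_induct)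
    case (less K)
    show ?case
    proof (cases "t = 0")
      case False
      then obtain n where n: "lead t n"
        using lead_exists by blast
      obtain f a where f: "f \<in> I" "lead f a" "mdvd a (c + n)" "\<forall>n. mdvd a (c + n) \<longrightarrow> mdvd a n"
        using leads[OF less.prems(2) lead_mult[OF h n]] by blast
      then obtain k where k: "n = a + k"
        by (auto simp: mdvd_def)
      obtain s where s: "below (key n) (t - s * f)"
        using reduce_lead[OF f(2), of t k] n k by metis
      have "h * (t - s * f) = h * t + (- h * s) * f"
        by (simp add: algebra_simps)
      then have "h * (t - s * f) \<in> I"
        using add[OF less.prems(2) mult[OF f(1), of "- h * s"]] by simp
      then have "t - s * f \<in> I"
        using less.IH[OF lead_key_less[OF n less.prems(1)] s] by blast
      then show ?thesis
        using add[of "t - s * f" "s * f"] mult[OF f(1)] by simp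
    qed (use \<open>0 \<in> I\<close> in simp)
  qed
  moreover note below_exists[of t]
  ultimately show ?thesis
    using assms(6) by blast
qed

lemma lead_mult_eq_0:
  assumes "lead f a" "f * t = 0"
  shows "t = 0"
  using lead_exists[of t] lead_mult[OF assms(1), of t] lead_nonzero assms(2) by metis

text \<open>In a principal ideal every leading monomial is a multiple of that of the generator, so
  \<open>regular_modulo\<close> applies.\<close>

lemma regular_modulo_one:
  assumes f: "lead f a" and h: "lead h c"
    and coprime: "\<And>n. mdvd a (c + n) \<Longrightarrow> mdvd a n"
    and eq: "h * t = f * q"
  shows "\<exists>q. t = f * q"
proof -
  let ?I = "{f * q | q. True}"
  have "t \<in> ?I"
  proof (rule regular_modulo[OF h])
    fix p m assume p: "p \<in> ?I" "lead p m"
    then obtain q where q: "p = f * q"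
      by blast
    then have "q \<noteq> 0"
      using p(2) by (auto dest: lead_nonzero)
    then obtain n where "lead q n"
      using lead_exists by blast
    then have "mdvd a m"
      using lead_mult[OF f] p(2) q lead_unique unfolding mdvd_def by blast
    moreover have "f = f * 1"
      by simp
    then have "f \<in> ?I"
      by blast
    ultimately show "\<exists>f\<in>?I. \<exists>a. lead f a \<and> mdvd a m \<and> (\<forall>n. mdvd a (c + n) \<longrightarrow> mdvd a n)"
      using f coprime by blast
  next
    fix p q assume "p \<in> ?I" "q \<in> ?I"
    then obtain q1 q2 where "p = f * q1" "q = f * q2"
      by blast
    then have "p + q = f * (q1 + q2)"
      by (simp add: algebra_simps)
    then show "p + q \<in> ?I" by blast
  next
    fix p s assume "p \<in> ?I"
    then obtain q1 where "p = f * q1"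
      by blast
    then have "s * p = f * (s * q1)"
      by (simp add: algebra_simps)
    then show "s * p \<in> ?I" by blast
  next
    have "0 = f * 0" by simp
    then show "0 \<in> ?I" by blast
  qed (use eq in blast)
  then show ?thesis by blast
qed

text \<open>Here \<open>lead_mem_two_generated\<close> says that \<open>f\<close> and
  \<open>g\<close> form a Groebner basis, which is what \<open>regular_modulo\<close>
  requires.\<close>

lemma regular_modulo_two:
  assumes f: "lead f a" and g: "lead g b" and h: "lead h c"
    and coprime: "\<And>n. mdvd b (a + n) \<Longrightarrow> mdvd b n"
      "\<And>n. mdvd a (c + n) \<Longrightarrow> mdvd a n" "\<And>n. mdvd b (c + n) \<Longrightarrow> mdvd b n"
    and eq: "h * t = f * q + g * r"
  shows "\<exists>q r. t = f * q + g * r"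
proof -
  let ?I = "{f * q + g * r | q r. True}"
  have "t \<in> ?I"
  proof (rule regular_modulo[OF h])
    fix p m assume p: "p \<in> ?I" "lead p m"
    then have "mdvd a m \<or> mdvd b m"
      using lead_mem_two_generated[OF f g coprime(1)] by blast
    moreover have "f = f * 1 + g * 0" "g = f * 0 + g * 1"
      by simp_all
    then have "f \<in> ?I" "g \<in> ?I"
      by blast+
    ultimately show "\<exists>f\<in>?I. \<exists>a. lead f a \<and> mdvd a m \<and> (\<forall>n. mdvd a (c + n) \<longrightarrow> mdvd a n)"
      using f g coprime by blast
  next
    fix p q assume "p \<in> ?I" "q \<in> ?I"
    then obtain q1 r1 q2 r2 where "p = f * q1 + g * r1" "q = f * q2 + g * r2"
      by blast
    then have "p + q = f * (q1 + q2) + g * (r1 + r2)"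
      by (simp add: algebra_simps)
    then show "p + q \<in> ?I" by blast
  next
    fix p s assume "p \<in> ?I"
    then obtain q1 r1 where "p = f * q1 + g * r1"
      by blast
    then have "s * p = f * (s * q1) + g * (s * r1)"
      by (simp add: algebra_simps)
    then show "s * p \<in> ?I" by blast
  next
    have "0 = f * 0 + g * 0" by simp
    then show "0 \<in> ?I" by blast
  qed (use eq in blast)
  then show ?thesis by blast
qed

end

section \<open>The leading monomials\<close>

lemma x_el_eqs:
  "x_el 1 2 = Var X12" "x_el 1 3 = Var X13" "x_el 1 4 = Var X14"
  "x_el 2 3 = Var X23" "x_el 2 4 = Var X24" "x_el 3 4 = Var X34"
  by (simp_all add: x_el_def x_up_def)

lemma y_el_eqs:
  "y_el 1 2 = Var Y12" "y_el 1 3 = Var Y13" "y_el 1 4 = Var Y14"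
  "y_el 2 3 = Var Y23" "y_el 2 4 = Var Y24" "y_el 3 4 = Var Y34"
  by (simp_all add: y_el_def y_up_def)

lemma atLeastAtMost_1_4_diff:
  "{1..4} - {1} = {2, 3, 4 :: nat}" "{1..4} - {2} = {1, 3, 4 :: nat}"
  "{1..4} - {3} = {1, 2, 4 :: nat}" "{1..4} - {4} = {1, 2, 3 :: nat}"
  by auto

lemma u_el_eqs:
  "u_el 1 = - Var X12 * Var Z134 + Var X13 * Var Z124 - Var X14 * Var Z123"
  "u_el 2 = - Var X12 * Var Z234 + Var X23 * Var Z124 - Var X24 * Var Z123"
  "u_el 3 = - Var X13 * Var Z234 + Var X23 * Var Z134 - Var X34 * Var Z123"
  "u_el 4 = - Var X14 * Var Z234 + Var X24 * Var Z134 - Var X34 * Var Z124"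
  unfolding u_el_def atLeastAtMost_1_4_diff
  by (simp_all add: x_el_def x_up_def z_hat_def z123_def z124_def z134_def z234_def)

lemma v_el_eqs:
  "v_el 1 = - Var Y12 * Var Z134 + Var Y13 * Var Z124 - Var Y14 * Var Z123"
  "v_el 2 = - Var Y12 * Var Z234 + Var Y23 * Var Z124 - Var Y24 * Var Z123"
  "v_el 3 = - Var Y13 * Var Z234 + Var Y23 * Var Z134 - Var Y34 * Var Z123"
  "v_el 4 = - Var Y14 * Var Z234 + Var Y24 * Var Z134 - Var Y34 * Var Z124"
  unfolding v_el_def atLeastAtMost_1_4_diff
  by (simp_all add: y_el_def y_up_def z_hat_def z123_def z124_def z134_def z234_def)

lemma Delta_eq: "Delta (i, j) (k, l) = x_el i j * y_el k l - x_el k l * y_el i j"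
  by (simp add: Delta_def)

lemmas in_variables =
  u123_def u124_def u134_def u234_def u_disc_def a_el_def b_el_def c_el_def
  delta1_def delta2_def delta3_def Delta_eq x_el_eqs y_el_eqs u_el_eqs v_el_eqs
  z123_def z124_def z134_def z234_def

section \<open>A monomial order from weights given by primes\<close>

lemma UNIV_var:
  "UNIV = {X12, X13, X14, X23, X24, X34, Y12, Y13, Y14, Y23, Y24, Y34, Z123, Z124, Z134, Z234}"
  by (auto intro: var.exhaust)

text \<open>Found by computer search: not every assignment of distinct primes makes the leading
  monomials in \<open>lead_u_disc\<close>, \<open>lead_u123\<close> and \<open>lead_minor_34\<close> pairwise coprime.\<close>

definition var_prime :: "var \<Rightarrow> nat" where
  "var_prime t = (case t of X12 \<Rightarrow> 43 | X13 \<Rightarrow> 13 | X14 \<Rightarrow> 2 | X23 \<Rightarrow> 7 | X24 \<Rightarrow> 41 | X34 \<Rightarrow> 23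
    | Y12 \<Rightarrow> 53 | Y13 \<Rightarrow> 11 | Y14 \<Rightarrow> 29 | Y23 \<Rightarrow> 17 | Y24 \<Rightarrow> 19 | Y34 \<Rightarrow> 31
    | Z123 \<Rightarrow> 3 | Z124 \<Rightarrow> 5 | Z134 \<Rightarrow> 37 | Z234 \<Rightarrow> 47)"

text \<open>Comparing these products is the weight order with weights log p; unique factorization
  rules out ties.\<close>

definition var_key :: "(var \<Rightarrow>\<^sub>0 nat) \<Rightarrow> nat" where
  "var_key m = (\<Prod>t\<in>UNIV. var_prime t ^ Poly_Mapping.lookup m t)"

lemma prime_var_prime: "prime (var_prime t)"
  by (cases t) (simp_all add: var_prime_def)

lemma inj_var_prime: "inj var_prime"
proof (rule injI)
  fix s t assume "var_prime s = var_prime t"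
  then show "s = t"
    by (cases s; cases t) (simp_all add: var_prime_def)
qed

lemma finite_UNIV_var: "finite (UNIV :: var set)"
  by (simp add: UNIV_var)

lemma multiplicity_var_key: "multiplicity (var_prime t) (var_key m) = Poly_Mapping.lookup m t"
proof -
  \<comment> \<open>Reindexing by the primes themselves gives a prime factorization, from which the
    exponents can be read off.\<close>
  have "var_key m = (\<Prod>p\<in>range var_prime. p ^ Poly_Mapping.lookup m (the_inv var_prime p))"
    unfolding var_key_def by (subst prod.reindex[OF inj_var_prime])
      (simp add: the_inv_f_f inj_var_prime)
  then have "multiplicity (var_prime t) (var_key m) =
      (if var_prime t \<in> range var_prime
       then Poly_Mapping.lookup m (the_inv var_prime (var_prime t)) else 0)"
    using prime_var_prime
    by (simp only:) (rule multiplicity_prod_prime_powers, auto simp: finite_UNIV_var)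
  then show ?thesis
    by (simp add: the_inv_f_f inj_var_prime)
qed

interpretation var_order: monomial_order var_key
proof
  fix m n :: "var \<Rightarrow>\<^sub>0 nat"
  show "var_key (m + n) = var_key m * var_key n"
    by (simp add: var_key_def lookup_add power_add prod.distrib)
  show "0 < var_key m"
    using prime_var_prime by (auto simp: var_key_def prime_gt_0_nat finite_UNIV_var intro: prod_pos)
  show "inj var_key"
    by (rule injI, rule poly_mapping_eqI) (metis multiplicity_var_key)
qed

lemma var_key_single: "var_key (Poly_Mapping.single t k) = var_prime t ^ k"
proof -
  have "var_key (Poly_Mapping.single t k) = (\<Prod>s\<in>UNIV. if s = t then var_prime t ^ k else 1)"
    unfolding var_key_def by (rule prod.cong) (auto simp: lookup_single when_def)
  then show ?thesis
    by (simp add: finite_UNIV_var)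
qed

section \<open>Numerical bounds for expanded polynomials\<close>

lemma below_Var: "var_order.below (Suc (var_prime t)) (Var t)"
  unfolding Var_def by (rule var_order.below_single) (simp add: var_key_single)

lemma below_numeral: "var_order.below (Suc 1) (numeral n)"
  unfolding single_numeral[symmetric]
  by (rule var_order.below_single) (simp add: var_key_def)

text \<open>\<open>below (Suc K)\<close> says that keys are at most \<open>K\<close>. Such weak
  bounds multiply without loss, whereas \<open>below_mult\<close> would produce
  \<open>Suc K * Suc L\<close>.\<close>

lemma below_Suc_mult:
  assumes "var_order.below (Suc K) p" "var_order.below (Suc L) q"
  shows "var_order.below (Suc (K * L)) (p * q)"
proof -
  have "var_key a * var_key b \<le> K * L"
    if "a \<in> Poly_Mapping.keys p" "b \<in> Poly_Mapping.keys q" for a b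
    using assms that by (auto simp: var_order.below_def less_Suc_eq_le intro: mult_le_mono)
  then show ?thesis
    unfolding var_order.below_def using keys_mult[of p q]
    by (fastforce simp: var_order.key_add less_Suc_eq_le)
qed

lemma below_Suc_less: "var_order.below (Suc K) p \<Longrightarrow> K < L \<Longrightarrow> var_order.below L p"
  by (rule var_order.below_mono) auto

text \<open>The list is read as a multiset: repetitions give exponents.\<close>

definition monomial :: "'v list \<Rightarrow> 'v \<Rightarrow>\<^sub>0 nat" where
  "monomial ts = (\<Sum>t\<leftarrow>ts. Poly_Mapping.single t 1)"

lemma single_monomial:
  "Poly_Mapping.single (monomial ts) c = Poly_Mapping.single 0 c * (\<Prod>t\<leftarrow>ts. Var t)"
proof (induction ts arbitrary: c)
  case (Cons t ts)
  have "Poly_Mapping.single (monomial (t # ts)) c = Var t * Poly_Mapping.single (monomial ts) c"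
    by (simp add: monomial_def Var_def mult_single)
  then show ?case
    using Cons[of c] by (simp add: mult.left_commute)
qed (simp add: monomial_def)

lemma lookup_monomial: "t \<notin> set ts \<Longrightarrow> Poly_Mapping.lookup (monomial ts) t = 0"
  by (induction ts) (auto simp: monomial_def lookup_add lookup_single when_def)

lemma var_key_monomial: "var_key (monomial ts) = (\<Prod>t\<leftarrow>ts. var_prime t)"
proof (induction ts)
  case Nil
  then show ?case
    by (simp add: monomial_def var_key_def)
next
  case (Cons t ts)
  then show ?case
    by (simp add: monomial_def var_order.key_add var_key_single)
qed

text \<open>Turns a claim about leading monomials into comparisons of explicit products of
  primes.\<close>

lemma lead_monomialI:
  assumes "c \<noteq> 0"
    and "var_order.below (\<Prod>t\<leftarrow>ts. var_prime t) (p - Poly_Mapping.single 0 c * (\<Prod>t\<leftarrow>ts. Var t))"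
  shows "var_order.lead p (monomial ts)"
  unfolding var_order.lead_def var_key_monomial single_monomial using assms by blast

lemma mdvd_disjointD:
  assumes "var_order.mdvd (monomial ts) (monomial ss + n)" and disjoint: "set ts \<inter> set ss = {}"
  shows "var_order.mdvd (monomial ts) n"
proof -
  let ?a = "monomial ts"
  obtain d where d: "monomial ss + n = ?a + d"
    using assms(1) by (auto simp: var_order.mdvd_def)
  \<comment> \<open>The subtraction is truncated. It is exact at the variables of \<open>ts\<close>,
    where \<open>d\<close> shows that \<open>n\<close> has a large enough exponent, and elsewhere
    \<open>?a\<close> has exponent zero.\<close>
  have "Poly_Mapping.lookup n t = Poly_Mapping.lookup (?a + (n - ?a)) t" for t
    using disjoint lookup_monomial[of t ts] lookup_monomial[of t ss]
      arg_cong[OF d, of "\<lambda>m. Poly_Mapping.lookup m t"]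
    by (cases "t \<in> set ts") (auto simp: lookup_add lookup_minus disjoint_iff)
  then have "n = ?a + (n - ?a)"
    by (intro poly_mapping_eqI)
  then show ?thesis
    by (auto simp: var_order.mdvd_def)
qed

lemmas below_rules = var_order.below_add var_order.below_diff var_order.below_uminus

text \<open>X12 Y34 leads \<open>b_el\<close> because 43 * 31 exceeds 53 * 23, and its square
  exceeds X12 X34 Y12 Y34, the largest monomial of \<open>a_el * c_el\<close>.\<close>

lemma lead_u_disc: "var_order.lead (u_disc :: 'k::field A) (monomial [X12, X12, Y34, Y34])"
proof (rule lead_monomialI[of 1])
  show "var_order.below (\<Prod>t\<leftarrow>[X12, X12, Y34, Y34]. var_prime t)
      (u_disc - Poly_Mapping.single 0 1 * (\<Prod>t\<leftarrow>[X12, X12, Y34, Y34]. Var t) :: 'k A)"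
    unfolding in_variables
    by (simp add: algebra_simps power2_eq_square;
      intro below_rules; rule below_Suc_less,
      (rule below_Suc_mult below_Var below_numeral)+,
      simp add: var_prime_def)
qed simp

text \<open>The characteristic enters here: the leading term 2 X13 Y12 Z234, from the summand with
  \<open>Delta (1,2) (1,3)\<close>, has coefficient 2.\<close>

lemma lead_u123:
  assumes "(2 :: 'k) \<noteq> 0"
  shows "var_order.lead (u123 :: 'k::field A) (monomial [X13, Y12, Z234])"
proof (rule lead_monomialI[of 2])
  show "var_order.below (\<Prod>t\<leftarrow>[X13, Y12, Z234]. var_prime t)
      (u123 - Poly_Mapping.single 0 2 * (\<Prod>t\<leftarrow>[X13, Y12, Z234]. Var t) :: 'k A)"
    unfolding in_variables
    by (simp add: algebra_simps power2_eq_square;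
      intro below_rules; rule below_Suc_less,
      (rule below_Suc_mult below_Var below_numeral)+,
      simp add: var_prime_def)
qed (use assms in simp)

text \<open>Minus the determinant of the last two rows of \<open>d3\<close>.\<close>

abbreviation "minor_34 \<equiv> u_el 4 * v_el 3 - u_el 3 * v_el 4"

text \<open>The product of the leading monomials X24 Z134 of \<open>u_el 4\<close> and Y23 Z134 of
  \<open>v_el 3\<close> has key 954193; the largest monomial of \<open>u_el 3 * v_el 4\<close>, X13
  Y14 Z234^2, has key 832793.\<close>

lemma lead_minor_34:
  "var_order.lead (minor_34 :: 'k::field A) (monomial [X24, Y23, Z134, Z134])"
proof (rule lead_monomialI[of 1])
  show "var_order.below (\<Prod>t\<leftarrow>[X24, Y23, Z134, Z134]. var_prime t)
      (minor_34 - Poly_Mapping.single 0 1 * (\<Prod>t\<leftarrow>[X24, Y23, Z134, Z134]. Var t) :: 'k A)"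
    unfolding in_variables
    by (simp add: algebra_simps power2_eq_square;
      intro below_rules; rule below_Suc_less,
      (rule below_Suc_mult below_Var below_numeral)+,
      simp add: var_prime_def)
qed simp

section \<open>Null homotopies\<close>

lemma mult_mat_of_rows_list_index:
  assumes "i < length rs" "dim_vec w = n"
  shows "(mat_of_rows_list n rs *\<^sub>v w) $ i = (\<Sum>j<n. rs ! i ! j * w $ j)"
  using assms by (simp add: mat_of_rows_list_def scalar_prod_def lessThan_atLeast0)

lemma mat_of_rows_list_carrierI: "length rs = m \<Longrightarrow> mat_of_rows_list n rs \<in> carrier_mat m n"
  by (simp add: mat_of_rows_list_def)

text \<open>Let \<open>N\<close> be the block of \<^const>\<open>d2\<close> in the first four rows and last four columns, and let
  \<open>T\<close> be the block of \<open>null_homotopy0\<close> in the last four rows and first four columns. Then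
  \<open>N T = u\<close>. Up to signs in the basis vectors this is the matrix factorization
  \<open>(2 X Y\<^sup>* - b)\<^sup>2 = b\<^sup>2 - 4 a c\<close>, where \<open>X\<close>, \<open>Y\<close> are the skew-symmetric matrices of the variables
  and \<open>Y\<^sup>*\<close> is the Pfaffian adjoint of \<open>Y\<close>.\<close>

definition null_homotopy0 :: "'k::field A mat" where
  "null_homotopy0 = mat_of_rows_list 5
    [[0, 0, 0, 0, 0],
     [0, 0, 0, 0, 0],
     [- delta1 + delta2 - delta3, 2 * Delta (1,3) (1,4),
       2 * Delta (1,2) (1,4), - 2 * Delta (1,2) (1,3), 0],
     [- 2 * Delta (2,3) (2,4), - delta1 - delta2 + delta3,
       - 2 * Delta (1,2) (2,4), 2 * Delta (1,2) (2,3), 0],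
     [- 2 * Delta (2,3) (3,4), - 2 * Delta (1,3) (3,4),
       - delta1 - delta2 - delta3, 2 * Delta (1,3) (2,3), 0],
     [2 * Delta (2,4) (3,4), 2 * Delta (1,4) (3,4),
       2 * Delta (1,4) (2,4), delta1 - delta2 - delta3, 0]]"

text \<open>The homotopy for \<^const>\<open>u123\<close> on \<open>A\<^sup>6\<close>, found by solving the linear system for its
  coefficients in the bidegrees that can occur.\<close>

definition null_homotopy1 :: "'k::field A mat" where
  "null_homotopy1 = mat_of_rows_list 5
    [[2 * x_el 2 3, 2 * x_el 1 3, 2 * x_el 1 2, 0, 0],
     [- 2 * y_el 2 3, - 2 * y_el 1 3, - 2 * y_el 1 2, 0, 0],
     [z123, 0, 0, 0, 2 * Delta (1,2) (1,3)],
     [0, z123, 0, 0, - 2 * Delta (1,2) (2,3)],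
     [0, 0, - z123, 0, - 2 * Delta (1,3) (2,3)],
     [z234, z134, z124, 0, - delta1 + delta2 + delta3]]"

text \<open>The component from A^6 to A^2 of the homotopy for \<open>u123\<close>.\<close>

definition null_homotopy2 :: "'k::field A mat" where
  "null_homotopy2 = mat_of_rows_list 6
    [[z123, 0, - 2 * x_el 2 3, - 2 * x_el 1 3, 2 * x_el 1 2, 0],
     [0, z123, 2 * y_el 2 3, 2 * y_el 1 3, - 2 * y_el 1 2, 0]]"

text \<open>The adjugate of the block of \<^const>\<open>d3\<close> in its last two rows, padded by zeros.\<close>

definition minor_adjugate :: "'k::field A mat" where
  "minor_adjugate = mat_of_rows_list 6
    [[0, 0, 0, 0, u_el 4, u_el 3],
     [0, 0, 0, 0, - v_el 4, - v_el 3]]"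

lemma carrier_mats [simp]:
  "d1 \<in> carrier_mat 1 5" "d2 \<in> carrier_mat 5 6" "d3 \<in> carrier_mat 6 2"
  "null_homotopy0 \<in> carrier_mat 6 5" "null_homotopy1 \<in> carrier_mat 6 5"
  "null_homotopy2 \<in> carrier_mat 2 6" "minor_adjugate \<in> carrier_mat 2 6"
  by (simp_all add: d1_def d2_def d3_def null_homotopy0_def null_homotopy1_def
      null_homotopy2_def minor_adjugate_def mat_of_rows_list_carrierI)

lemmas dim_mats [simp] = carrier_mats[THEN carrier_matD(1)] carrier_mats[THEN carrier_matD(2)]

lemma d1_mult_vec:
  "dim_vec w = 5 \<Longrightarrow> (d1 *\<^sub>v w) $ 0 =
    u234 * w $ 0 + u134 * w $ 1 + u124 * w $ 2 + u123 * w $ 3 + u_disc * w $ 4"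
  by (simp add: d1_def mult_mat_of_rows_list_index eval_nat_numeral)

lemma less_numeral_cases:
  "i < 4 \<longleftrightarrow> i = 0 \<or> i = 1 \<or> i = 2 \<or> i = (3::nat)"
  "i < 2 \<longleftrightarrow> i = 0 \<or> i = (1::nat)"
  "i < 5 \<longleftrightarrow> i = 0 \<or> i = 1 \<or> i = 2 \<or> i = 3 \<or> i = (4::nat)"
  "i < 6 \<longleftrightarrow> i = 0 \<or> i = 1 \<or> i = 2 \<or> i = 3 \<or> i = 4 \<or> i = (5::nat)"
  by auto

lemma d2_mult_vec:
  assumes "dim_vec w = 6"
  shows
    "(d2 *\<^sub>v w) $ 0 = v_el 1 * w $ 0 + u_el 1 * w $ 1 + (- delta1 + delta2 - delta3) * w $ 2
      + 2 * Delta (1,3) (1,4) * w $ 3 + (- 2 * Delta (1,2) (1,4)) * w $ 4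
      + (- 2 * Delta (1,2) (1,3)) * w $ 5"
    "(d2 *\<^sub>v w) $ 1 = (- v_el 2) * w $ 0 + (- u_el 2) * w $ 1
      + (- 2 * Delta (2,3) (2,4)) * w $ 2 + (- delta1 - delta2 + delta3) * w $ 3
      + 2 * Delta (1,2) (2,4) * w $ 4 + 2 * Delta (1,2) (2,3) * w $ 5"
    "(d2 *\<^sub>v w) $ 2 = v_el 3 * w $ 0 + u_el 3 * w $ 1 + 2 * Delta (2,3) (3,4) * w $ 2
      + 2 * Delta (1,3) (3,4) * w $ 3 + (- delta1 - delta2 - delta3) * w $ 4
      + (- 2 * Delta (1,3) (2,3)) * w $ 5"
    "(d2 *\<^sub>v w) $ 3 = v_el 4 * w $ 0 + u_el 4 * w $ 1 + 2 * Delta (2,4) (3,4) * w $ 2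
      + 2 * Delta (1,4) (3,4) * w $ 3 + (- 2 * Delta (1,4) (2,4)) * w $ 4
      + (delta1 - delta2 - delta3) * w $ 5"
    "(d2 *\<^sub>v w) $ 4 = (- z234) * w $ 2 + (- z134) * w $ 3 + z124 * w $ 4 + z123 * w $ 5"
  using assms by (simp_all add: mult_mat_of_rows_list_index d2_def eval_nat_numeral)

lemma d3_mult_vec:
  assumes "dim_vec w = 2"
  shows
    "(d3 *\<^sub>v w) $ 0 = b_el * w $ 0 + 2 * a_el * w $ 1"
    "(d3 *\<^sub>v w) $ 1 = (- 2 * c_el) * w $ 0 + (- b_el) * w $ 1"
    "(d3 *\<^sub>v w) $ 2 = (- v_el 1) * w $ 0 + (- u_el 1) * w $ 1"
    "(d3 *\<^sub>v w) $ 3 = v_el 2 * w $ 0 + u_el 2 * w $ 1"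
    "(d3 *\<^sub>v w) $ 4 = v_el 3 * w $ 0 + u_el 3 * w $ 1"
    "(d3 *\<^sub>v w) $ 5 = (- v_el 4) * w $ 0 + (- u_el 4) * w $ 1"
  using assms by (simp_all add: mult_mat_of_rows_list_index d3_def eval_nat_numeral)

lemma null_homotopy0_mult_vec:
  assumes "dim_vec w = 5"
  shows
    "(null_homotopy0 *\<^sub>v w) $ 0 = 0"
    "(null_homotopy0 *\<^sub>v w) $ 1 = 0"
    "(null_homotopy0 *\<^sub>v w) $ 2 = (- delta1 + delta2 - delta3) * w $ 0
      + 2 * Delta (1,3) (1,4) * w $ 1 + 2 * Delta (1,2) (1,4) * w $ 2
      + (- 2 * Delta (1,2) (1,3)) * w $ 3"
    "(null_homotopy0 *\<^sub>v w) $ 3 = (- 2 * Delta (2,3) (2,4)) * w $ 0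
      + (- delta1 - delta2 + delta3) * w $ 1 + (- 2 * Delta (1,2) (2,4)) * w $ 2
      + 2 * Delta (1,2) (2,3) * w $ 3"
    "(null_homotopy0 *\<^sub>v w) $ 4 = (- 2 * Delta (2,3) (3,4)) * w $ 0
      + (- 2 * Delta (1,3) (3,4)) * w $ 1 + (- delta1 - delta2 - delta3) * w $ 2
      + 2 * Delta (1,3) (2,3) * w $ 3"
    "(null_homotopy0 *\<^sub>v w) $ 5 = 2 * Delta (2,4) (3,4) * w $ 0 + 2 * Delta (1,4) (3,4) * w $ 1
      + 2 * Delta (1,4) (2,4) * w $ 2 + (delta1 - delta2 - delta3) * w $ 3"
  using assms by (simp_all add: mult_mat_of_rows_list_index null_homotopy0_def eval_nat_numeral)

lemma null_homotopy1_mult_vec: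
  assumes "dim_vec w = 5"
  shows
    "(null_homotopy1 *\<^sub>v w) $ 0 = 2 * x_el 2 3 * w $ 0 + 2 * x_el 1 3 * w $ 1
      + 2 * x_el 1 2 * w $ 2"
    "(null_homotopy1 *\<^sub>v w) $ 1 = (- 2 * y_el 2 3) * w $ 0 + (- 2 * y_el 1 3) * w $ 1
      + (- 2 * y_el 1 2) * w $ 2"
    "(null_homotopy1 *\<^sub>v w) $ 2 = z123 * w $ 0 + 2 * Delta (1,2) (1,3) * w $ 4"
    "(null_homotopy1 *\<^sub>v w) $ 3 = z123 * w $ 1 + (- 2 * Delta (1,2) (2,3)) * w $ 4"
    "(null_homotopy1 *\<^sub>v w) $ 4 = (- z123) * w $ 2 + (- 2 * Delta (1,3) (2,3)) * w $ 4"
    "(null_homotopy1 *\<^sub>v w) $ 5 = z234 * w $ 0 + z134 * w $ 1 + z124 * w $ 2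
      + (- delta1 + delta2 + delta3) * w $ 4"
  using assms by (simp_all add: mult_mat_of_rows_list_index null_homotopy1_def eval_nat_numeral)

lemma null_homotopy2_mult_vec:
  assumes "dim_vec w = 6"
  shows
    "(null_homotopy2 *\<^sub>v w) $ 0 = z123 * w $ 0 + (- 2 * x_el 2 3) * w $ 2
      + (- 2 * x_el 1 3) * w $ 3 + 2 * x_el 1 2 * w $ 4"
    "(null_homotopy2 *\<^sub>v w) $ 1 = z123 * w $ 1 + 2 * y_el 2 3 * w $ 2 + 2 * y_el 1 3 * w $ 3
      + (- 2 * y_el 1 2) * w $ 4"
  using assms by (simp_all add: mult_mat_of_rows_list_index null_homotopy2_def eval_nat_numeral)

lemma minor_adjugate_mult_vec:
  assumes "dim_vec w = 6"
  shows
    "(minor_adjugate *\<^sub>v w) $ 0 = u_el 4 * w $ 4 + u_el 3 * w $ 5"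
    "(minor_adjugate *\<^sub>v w) $ 1 = (- v_el 4) * w $ 4 + (- v_el 3) * w $ 5"
  using assms by (simp_all add: mult_mat_of_rows_list_index minor_adjugate_def eval_nat_numeral)

lemma d2_d3_mult_vec:
  assumes "dim_vec p = 2"
  shows "d2 *\<^sub>v (d3 *\<^sub>v p) = (0\<^sub>v 5 :: 'k::field A vec)"
proof (rule eq_vecI)
  fix i assume "i < dim_vec (0\<^sub>v 5 :: 'k A vec)"
  then show "(d2 *\<^sub>v (d3 *\<^sub>v p)) $ i = (0\<^sub>v 5 :: 'k A vec) $ i"
    using assms by (auto simp: less_numeral_cases d2_mult_vec d3_mult_vec
        simp del: index_mult_mat_vec One_nat_def)
      (simp_all add: in_variables algebra_simps del: One_nat_def)
qed simp

text \<open>Valid for all \<open>w\<close>, not only for cycles; \<open>kernel_d1\<close> applies it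
  to a vector outside the kernel of \<open>d2\<close> in general.\<close>

lemma homotopy_u123:
  assumes "dim_vec w = 6"
  shows "u123 \<cdot>\<^sub>v w =
      d3 *\<^sub>v (null_homotopy2 *\<^sub>v w) + null_homotopy1 *\<^sub>v (d2 *\<^sub>v (w :: 'k::field A vec))"
    (is "_ = ?r")
proof (rule eq_vecI)
  fix i assume "i < dim_vec ?r"
  then have "i < 6" by simp
  then show "(u123 \<cdot>\<^sub>v w) $ i = ?r $ i"
    using assms by (auto simp: less_numeral_cases d2_mult_vec d3_mult_vec null_homotopy1_mult_vec
        null_homotopy2_mult_vec simp del: index_mult_mat_vec One_nat_def)
      (simp_all add: in_variables algebra_simps del: One_nat_def)
qed (use assms in simp)

text \<open>In full, u w = d2 H w + (d1 w) e, where H is \<open>null_homotopy0\<close> and e is the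
  last basis vector of A^5, which \<open>d1\<close> sends to \<open>u_disc\<close>. The last term
  vanishes for cycles.\<close>

lemma homotopy_u_disc:
  assumes "dim_vec w = 5" and "(d1 *\<^sub>v w) $ 0 = 0"
  shows "d2 *\<^sub>v (null_homotopy0 *\<^sub>v w) = u_disc \<cdot>\<^sub>v (w :: 'k::field A vec)"
proof (rule eq_vecI)
  let ?l = "d2 *\<^sub>v (null_homotopy0 *\<^sub>v w)"
  fix i assume "i < dim_vec (u_disc \<cdot>\<^sub>v w)"
  then have "i < 5"
    using assms(1) by simp
  \<comment> \<open>Only the last coordinate sees the term (d1 w) e; the other four follow from N T
    = u for every \<open>w\<close>.\<close>
  have "?l $ 4 - u_disc * w $ 4 = - (d1 *\<^sub>v w) $ 0"
    using assms(1) by (simp add: d1_mult_vec d2_mult_vec null_homotopy0_mult_vec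
        del: index_mult_mat_vec One_nat_def) (simp add: in_variables algebra_simps del: One_nat_def)
  then have "?l $ 4 = u_disc * w $ 4"
    using assms(2) by simp
  moreover have "?l $ i = u_disc * w $ i" if "i < 4"
    using assms(1) that by (auto simp: less_numeral_cases d2_mult_vec null_homotopy0_mult_vec
        simp del: index_mult_mat_vec One_nat_def)
      (simp_all add: in_variables algebra_simps power2_eq_square del: One_nat_def)
  ultimately show "?l $ i = (u_disc \<cdot>\<^sub>v w) $ i"
    using \<open>i < 5\<close> assms(1) by (cases "i = 4") auto
qed (use assms in simp)

text \<open>Cramer's rule for the last two rows of \<open>d3\<close>.\<close>

lemma minor_adjugate_d3:
  assumes "dim_vec p = 2"
  shows "minor_adjugate *\<^sub>v (d3 *\<^sub>v p) = minor_34 \<cdot>\<^sub>v (p :: 'k::field A vec)"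
    (is "_ = ?r")
proof (rule eq_vecI)
  fix i assume "i < dim_vec ?r"
  then show "(minor_adjugate *\<^sub>v (d3 *\<^sub>v p)) $ i = ?r $ i"
    using assms by (auto simp: less_numeral_cases d3_mult_vec minor_adjugate_mult_vec
        simp del: index_mult_mat_vec One_nat_def)
      (simp_all add: algebra_simps)
qed (use assms in simp)

section \<open>Exactness\<close>

lemma mult_mat_smult_vec:
  fixes A :: "'a::comm_ring_1 mat"
  assumes "A \<in> carrier_mat m n" "v \<in> carrier_vec n"
  shows "A *\<^sub>v (k \<cdot>\<^sub>v v) = k \<cdot>\<^sub>v (A *\<^sub>v v)"
  using assms by (intro eq_vecI) (auto simp: scalar_prod_def sum_distrib_left mult.left_commute)

lemma vec_choice:
  assumes "\<And>i. i < n \<Longrightarrow> \<exists>y. Q i y"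
  shows "\<exists>w\<in>carrier_vec n. \<forall>i<n. Q i (w $ i)"
proof (rule bexI[of _ "vec n (\<lambda>i. SOME y. Q i y)"])
  show "\<forall>i<n. Q i (vec n (\<lambda>i. SOME y. Q i y) $ i)"
    using assms by (simp add: someI_ex)
qed simp

lemma smult_vec_cancel:
  fixes f :: "'a::comm_ring_1"
  assumes "\<forall>x. f * x = 0 \<longrightarrow> x = 0"
    and "v \<in> carrier_vec n" "w \<in> carrier_vec n" "f \<cdot>\<^sub>v v = f \<cdot>\<^sub>v w"
  shows "v = w"
proof (rule eq_vecI)
  fix i assume "i < dim_vec w"
  then have "f * v $ i = f * w $ i"
    using assms(2-4) by (metis carrier_vecD index_smult_vec(1))
  then have "f * (v $ i - w $ i) = 0"
    by (simp add: right_diff_distrib)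
  then show "v $ i = w $ i"
    using assms(1) by (metis right_minus_eq)
qed (use assms in simp)

lemma smult_vec_dvd:
  fixes f g :: "'a::comm_ring_1"
  assumes "\<forall>x y. g * x = f * y \<longrightarrow> (\<exists>z. x = f * z)"
    and "v \<in> carrier_vec n" "w \<in> carrier_vec n" "g \<cdot>\<^sub>v v = f \<cdot>\<^sub>v w"
  shows "\<exists>z\<in>carrier_vec n. v = f \<cdot>\<^sub>v z"
proof -
  have "\<exists>z. v $ i = f * z" if "i < n" for i
    using assms that by (metis carrier_vecD index_smult_vec(1))
  from vec_choice[of n "\<lambda>i y. v $ i = f * y"] this
  obtain z :: "'a vec" where "z \<in> carrier_vec n" "\<forall>i<n. v $ i = f * z $ i"
    by auto
  then show ?thesis
    using assms(2) by (intro bexI[of _ z] eq_vecI) auto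
qed

lemma smult_vec_dvd_two:
  fixes f g h :: "'a::comm_ring_1"
  assumes "\<forall>x y z. h * x = f * y + g * z \<longrightarrow> (\<exists>y z. x = f * y + g * z)"
    and "v \<in> carrier_vec n" "w \<in> carrier_vec n" "w' \<in> carrier_vec n"
    and "h \<cdot>\<^sub>v v = f \<cdot>\<^sub>v w + g \<cdot>\<^sub>v w'"
  shows "\<exists>a\<in>carrier_vec n. \<exists>b\<in>carrier_vec n. v = f \<cdot>\<^sub>v a + g \<cdot>\<^sub>v b"
proof -
  have "\<exists>y. \<exists>z. v $ i = f * y + g * z" if i: "i < n" for i
  proof (rule assms(1)[rule_format])
    have "(h \<cdot>\<^sub>v v) $ i = (f \<cdot>\<^sub>v w + g \<cdot>\<^sub>v w') $ i"
      by (simp only: assms(5))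
    then show "h * v $ i = f * w $ i + g * w' $ i"
      using i assms(2-4) by simp
  qed
  from vec_choice[of n "\<lambda>i y. \<exists>z. v $ i = f * y + g * z"] this
  obtain a :: "'a vec" where a: "a \<in> carrier_vec n"
    "\<forall>i<n. \<exists>z. v $ i = f * a $ i + g * z"
    by auto
  \<comment> \<open>The second vector is chosen after \<open>a\<close> is fixed, since the two
    cofactors of an entry depend on each other.\<close>
  from vec_choice[of n "\<lambda>i z. v $ i = f * a $ i + g * z"] a(2)
  obtain b :: "'a vec" where "b \<in> carrier_vec n" "\<forall>i<n. v $ i = f * a $ i + g * b $ i"
    by auto
  then show ?thesis
    using a(1) assms(2) by (intro bexI[of _ a] bexI[of _ b] eq_vecI) auto
qed

section \<open>Kernels of the three differentials\<close>

context
  assumes two: "(2 :: 'k::field) \<noteq> 0"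
begin

lemma u_disc_cancel: "\<forall>x. (u_disc :: 'k A) * x = 0 \<longrightarrow> x = 0"
  using var_order.lead_mult_eq_0[OF lead_u_disc] by blast

lemma u123_cancel: "\<forall>x. (u123 :: 'k A) * x = 0 \<longrightarrow> x = 0"
  using var_order.lead_mult_eq_0[OF lead_u123[OF two]] by blast

lemma minor_34_cancel: "\<forall>x. (minor_34 :: 'k A) * x = 0 \<longrightarrow> x = 0"
  using var_order.lead_mult_eq_0[OF lead_minor_34] by blast

text \<open>Coprimality here and below is disjointness of the variable sets {X12, Y34}, {X13, Y12,
  Z234} and {X24, Y23, Z134}.\<close>

lemma regular_u_disc_u123:
  "\<forall>x y. (u123 :: 'k A) * x = u_disc * y \<longrightarrow> (\<exists>z. x = u_disc * z)"
  by (intro allI impI, rule var_order.regular_modulo_one[OF lead_u_disc lead_u123[OF two]])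
    (auto intro: mdvd_disjointD)

lemma regular_u123_minor_34:
  "\<forall>x y. (minor_34 :: 'k A) * x = u123 * y \<longrightarrow> (\<exists>z. x = u123 * z)"
  by (intro allI impI, rule var_order.regular_modulo_one[OF lead_u123[OF two] lead_minor_34])
    (auto intro: mdvd_disjointD)

lemma regular_u_disc_u123_minor_34:
  "\<forall>x y z. (minor_34 :: 'k A) * x = u_disc * y + u123 * z \<longrightarrow>
    (\<exists>y z. x = u_disc * y + u123 * z)"
  by (intro allI impI,
      rule var_order.regular_modulo_two[OF lead_u_disc lead_u123[OF two] lead_minor_34])
    (auto intro: mdvd_disjointD)

text \<open>A maximal minor that is a nonzerodivisor forces injectivity.\<close>

lemma kernel_d3:
  assumes p: "p \<in> carrier_vec 2" and "d3 *\<^sub>v p = (0\<^sub>v 6 :: 'k A vec)"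
  shows "p = 0\<^sub>v 2"
proof (rule smult_vec_cancel[OF minor_34_cancel p])
  have "minor_34 \<cdot>\<^sub>v p = minor_adjugate *\<^sub>v (0\<^sub>v 6)"
    using minor_adjugate_d3[of p] p assms(2) by simp
  then show "minor_34 \<cdot>\<^sub>v p = minor_34 \<cdot>\<^sub>v 0\<^sub>v 2"
    by (intro eq_vecI) (auto simp: scalar_prod_def)
qed simp_all

text \<open>On a cycle the homotopy gives u123 w = d3 p. The adjugate shows that \<open>u123\<close>
  divides minor_34 p, hence \<open>p\<close>, and \<open>u123\<close> cancels.\<close>

lemma kernel_d2:
  assumes w: "w \<in> carrier_vec 6" and "d2 *\<^sub>v w = (0\<^sub>v 5 :: 'k A vec)"
  shows "\<exists>q\<in>carrier_vec 2. w = d3 *\<^sub>v q"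
proof -
  define p where "p = null_homotopy2 *\<^sub>v w"
  have p: "p \<in> carrier_vec 2"
    by (simp add: p_def carrier_vecI)
  have "null_homotopy1 *\<^sub>v 0\<^sub>v 5 = (0\<^sub>v 6 :: 'k A vec)"
    by (intro eq_vecI) (auto simp: scalar_prod_def)
  moreover have d3p: "d3 *\<^sub>v p \<in> carrier_vec 6"
    by (simp add: carrier_vecI)
  ultimately have w_eq: "u123 \<cdot>\<^sub>v w = d3 *\<^sub>v p"
    using homotopy_u123[of w] w assms(2) by (simp add: p_def)
  have "minor_34 \<cdot>\<^sub>v p = minor_adjugate *\<^sub>v (u123 \<cdot>\<^sub>v w)"
    using minor_adjugate_d3[of p] p w_eq by simp
  also have "\<dots> = u123 \<cdot>\<^sub>v (minor_adjugate *\<^sub>v w)"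
    by (rule mult_mat_smult_vec[OF carrier_mats(7) w])
  finally have eq: "minor_34 \<cdot>\<^sub>v p = u123 \<cdot>\<^sub>v (minor_adjugate *\<^sub>v w)" .
  have "minor_adjugate *\<^sub>v w \<in> carrier_vec 2"
    by (simp add: carrier_vecI)
  from smult_vec_dvd[OF regular_u123_minor_34 p this eq]
  obtain q where q: "q \<in> carrier_vec 2" "p = u123 \<cdot>\<^sub>v q"
    by blast
  have "d3 *\<^sub>v p = u123 \<cdot>\<^sub>v (d3 *\<^sub>v q)"
    unfolding q(2) by (rule mult_mat_smult_vec[OF carrier_mats(3) q(1)])
  then have "u123 \<cdot>\<^sub>v w = u123 \<cdot>\<^sub>v (d3 *\<^sub>v q)"
    using w_eq by simp
  moreover have "d3 *\<^sub>v q \<in> carrier_vec 6"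
    by (simp add: carrier_vecI)
  ultimately have "w = d3 *\<^sub>v q"
    using smult_vec_cancel[OF u123_cancel w] by blast
  then show ?thesis
    using q(1) by blast
qed

lemma kernel_d1:
  assumes w: "w \<in> carrier_vec 5" and "d1 *\<^sub>v w = (0\<^sub>v 1 :: 'k A vec)"
  shows "\<exists>t\<in>carrier_vec 6. w = d2 *\<^sub>v t"
proof -
  define t where "t = null_homotopy0 *\<^sub>v w"
  define s where "s = null_homotopy2 *\<^sub>v t"
  define r where "r = null_homotopy1 *\<^sub>v w"
  have t: "t \<in> carrier_vec 6" and s: "s \<in> carrier_vec 2" and r: "r \<in> carrier_vec 6"
    by (simp_all add: t_def s_def r_def carrier_vecI)
  have d2t: "d2 *\<^sub>v t = u_disc \<cdot>\<^sub>v w"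
    unfolding t_def using w assms(2) by (intro homotopy_u_disc) simp_all
  have "null_homotopy1 *\<^sub>v (u_disc \<cdot>\<^sub>v w) = u_disc \<cdot>\<^sub>v r"
    unfolding r_def by (rule mult_mat_smult_vec[OF carrier_mats(5) w])
  then have t_eq: "u123 \<cdot>\<^sub>v t = d3 *\<^sub>v s + u_disc \<cdot>\<^sub>v r"
    using homotopy_u123[of t] t d2t by (simp add: s_def)
  \<comment> \<open>The adjugate turns d3 s into minor_34 s, so that regularity can be applied to
    the entries of \<open>s\<close>.\<close>
  define t' r' where "t' = minor_adjugate *\<^sub>v t" and "r' = minor_adjugate *\<^sub>v r"
  have t': "t' \<in> carrier_vec 2" and r': "r' \<in> carrier_vec 2"
    by (simp_all add: t'_def r'_def carrier_vecI)
  have d3c: "d3 *\<^sub>v x \<in> carrier_vec 6" for x :: "'k A vec"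
    by (simp add: carrier_vecI)
  have "u123 \<cdot>\<^sub>v t' = minor_adjugate *\<^sub>v (d3 *\<^sub>v s + u_disc \<cdot>\<^sub>v r)"
    unfolding t'_def t_eq[symmetric] by (rule mult_mat_smult_vec[OF carrier_mats(7) t, symmetric])
  also have "\<dots> = minor_adjugate *\<^sub>v (d3 *\<^sub>v s) + minor_adjugate *\<^sub>v (u_disc \<cdot>\<^sub>v r)"
    by (rule mult_add_distrib_mat_vec[of _ 2 6]) (use r d3c in auto)
  also have "minor_adjugate *\<^sub>v (u_disc \<cdot>\<^sub>v r) = u_disc \<cdot>\<^sub>v r'"
    unfolding r'_def by (rule mult_mat_smult_vec[OF carrier_mats(7) r])
  finally have st: "u123 \<cdot>\<^sub>v t' = minor_34 \<cdot>\<^sub>v s + u_disc \<cdot>\<^sub>v r'"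
    using minor_adjugate_d3[of s] s by simp
  have "minor_34 \<cdot>\<^sub>v s = u_disc \<cdot>\<^sub>v (- r') + u123 \<cdot>\<^sub>v t'"
    unfolding st using s r' by (intro eq_vecI) auto
  from smult_vec_dvd_two[OF regular_u_disc_u123_minor_34 s _ t' this] r'
  obtain a b where a: "a \<in> carrier_vec 2" and b: "b \<in> carrier_vec 2"
    and s_eq: "s = u_disc \<cdot>\<^sub>v a + u123 \<cdot>\<^sub>v b"
    by auto
  have "d3 *\<^sub>v s = d3 *\<^sub>v (u_disc \<cdot>\<^sub>v a) + d3 *\<^sub>v (u123 \<cdot>\<^sub>v b)"
    unfolding s_eq by (rule mult_add_distrib_mat_vec[of _ 6 2]) (use a b in auto)
  also have "\<dots> = u_disc \<cdot>\<^sub>v (d3 *\<^sub>v a) + u123 \<cdot>\<^sub>v (d3 *\<^sub>v b)"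
    using mult_mat_smult_vec[of d3 6 2 a u_disc] mult_mat_smult_vec[of d3 6 2 b u123] a b by simp
  finally have t_eq2: "u123 \<cdot>\<^sub>v t = u_disc \<cdot>\<^sub>v (d3 *\<^sub>v a) + u123 \<cdot>\<^sub>v (d3 *\<^sub>v b) + u_disc \<cdot>\<^sub>v r"
    using t_eq by simp
  \<comment> \<open>With \<open>s\<close> substituted and u123 d3 b moved to the left, all remaining
    terms are multiples of \<open>u_disc\<close>.\<close>
  have "u123 \<cdot>\<^sub>v (t - d3 *\<^sub>v b) = u_disc \<cdot>\<^sub>v (d3 *\<^sub>v a + r)"
  proof (rule eq_vecI)
    fix i assume "i < dim_vec (u_disc \<cdot>\<^sub>v (d3 *\<^sub>v a + r))"
    then have i: "i < 6"
      using r by simp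
    have "(u123 \<cdot>\<^sub>v t) $ i = (u_disc \<cdot>\<^sub>v (d3 *\<^sub>v a) + u123 \<cdot>\<^sub>v (d3 *\<^sub>v b) + u_disc \<cdot>\<^sub>v r) $ i"
      by (simp only: t_eq2)
    then show "(u123 \<cdot>\<^sub>v (t - d3 *\<^sub>v b)) $ i = (u_disc \<cdot>\<^sub>v (d3 *\<^sub>v a + r)) $ i"
      using i t r by (simp add: algebra_simps del: index_mult_mat_vec)
  qed (use t r in simp)
  moreover have "t - d3 *\<^sub>v b \<in> carrier_vec 6"
    by (rule carrier_vecI) simp
  moreover have "d3 *\<^sub>v a + r \<in> carrier_vec 6"
    by (rule add_carrier_vec[OF d3c r])
  ultimately obtain y where y: "y \<in> carrier_vec 6" and ty: "t - d3 *\<^sub>v b = u_disc \<cdot>\<^sub>v y"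
    using smult_vec_dvd[OF regular_u_disc_u123] by blast
  have "d2 *\<^sub>v (t - d3 *\<^sub>v b) = d2 *\<^sub>v t - d2 *\<^sub>v (d3 *\<^sub>v b)"
    by (rule mult_minus_distrib_mat_vec[of _ 5 6]) (use t d3c in auto)
  also have "\<dots> = d2 *\<^sub>v t"
    using d2_d3_mult_vec[of b] b by (intro eq_vecI) (simp_all del: index_mult_mat_vec)
  finally have "u_disc \<cdot>\<^sub>v w = u_disc \<cdot>\<^sub>v (d2 *\<^sub>v y)"
    using mult_mat_smult_vec[of d2 5 6 y u_disc] y by (simp add: ty d2t)
  moreover have "d2 *\<^sub>v y \<in> carrier_vec 5"
    by (simp add: carrier_vecI)
  ultimately have "w = d2 *\<^sub>v y"
    using smult_vec_cancel[OF u_disc_cancel w] by blast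
  then show ?thesis
    using y by blast
qed

end

lemma mat_of_rows_list_index: "i < length rs \<Longrightarrow> j < n \<Longrightarrow> mat_of_rows_list n rs $$ (i, j) = rs ! i ! j"
  by (simp add: mat_of_rows_list_def)

lemma d1_d2_mult_vec:
  assumes "dim_vec w = 6"
  shows "d1 *\<^sub>v (d2 *\<^sub>v w) = (0\<^sub>v 1 :: 'k::field A vec)"
proof -
  \<comment> \<open>Testing on the columns of \<open>d2\<close> keeps the unknown entries of
    \<open>w\<close> out of the expansion.\<close>
  have "(d1 *\<^sub>v col d2 j) $ 0 = (0 :: 'k A)" if "j < 6" for j
  proof -
    have "(d1 *\<^sub>v col d2 j) $ 0 = u234 * d2 $$ (0, j) + u134 * d2 $$ (1, j) + u124 * d2 $$ (2, j)
        + u123 * d2 $$ (3, j) + u_disc * (d2 $$ (4, j) :: 'k A)"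
      using that by (simp add: d1_mult_vec del: index_mult_mat_vec)
    also have "\<dots> = 0"
      using that unfolding d2_def
      by (auto simp: less_numeral_cases mat_of_rows_list_index simp del: One_nat_def)
        (simp_all add: in_variables algebra_simps power2_eq_square del: One_nat_def)
    finally show ?thesis .
  qed
  then have "d1 * d2 = (0\<^sub>m 1 6 :: 'k A mat)"
    by (intro eq_matI) simp_all
  moreover have "d1 *\<^sub>v (d2 *\<^sub>v w) = (d1 * d2) *\<^sub>v w"
    using assoc_mult_mat_vec[OF carrier_mats(1,2) carrier_vecI[OF assms]] by (rule sym)
  ultimately have "d1 *\<^sub>v (d2 *\<^sub>v w) = 0\<^sub>m 1 6 *\<^sub>v w"
    by simp
  also have "\<dots> = 0\<^sub>v 1"
    using assms by (intro eq_vecI) (simp_all add: scalar_prod_def)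
  finally show ?thesis .
qed

section \<open>Minimality and grading\<close>

lemma module_times: "Modules.module ((*) :: 'a \<Rightarrow> 'a \<Rightarrow> 'a::comm_ring_1)"
  by unfold_locales (simp_all add: algebra_simps)

lemma mem_J_ideal:
  "x \<in> J_ideal \<longleftrightarrow>
    (\<exists>a b c d e. x = u234 * a + u134 * b + u124 * c + u123 * d + u_disc * (e :: 'k::field A))"
proof -
  \<comment> \<open>The generators are peeled off the span one at a time, down to the zero span of
    the empty set.\<close>
  have "x \<in> J_ideal \<longleftrightarrow>
      (\<exists>a b c d e. x - a * u234 - b * u134 - c * u124 - d * u123 - e * u_disc = 0)"
    unfolding J_ideal_def ideal_generated_def
    by (simp only: module.span_breakdown_eq[OF module_times]
        module.span_empty[OF module_times] singleton_iff)
  also have "\<dots> \<longleftrightarrow>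
      (\<exists>a b c d e. x = u234 * a + u134 * b + u124 * c + u123 * d + u_disc * e)"
    by (simp only: mult.commute[of _ u234] mult.commute[of _ u134] mult.commute[of _ u124]
        mult.commute[of _ u123] mult.commute[of _ u_disc] diff_diff_eq right_minus_eq)
  finally show ?thesis .
qed

lemma irrelevant_ideal_closed:
  fixes p q :: "('v, 'k::comm_ring_1) mpoly"
  shows "Var t \<in> (irrelevant_ideal :: ('v, 'k) mpoly set)"
    and "0 \<in> (irrelevant_ideal :: ('v, 'k) mpoly set)"
    and "p \<in> irrelevant_ideal \<Longrightarrow> q \<in> irrelevant_ideal \<Longrightarrow> p + q \<in> irrelevant_ideal"
    and "p \<in> irrelevant_ideal \<Longrightarrow> q \<in> irrelevant_ideal \<Longrightarrow> p - q \<in> irrelevant_ideal"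
    and "p \<in> irrelevant_ideal \<Longrightarrow> - p \<in> irrelevant_ideal"
    and "p \<in> irrelevant_ideal \<Longrightarrow> q * p \<in> irrelevant_ideal"
    and "p \<in> irrelevant_ideal \<Longrightarrow> p * q \<in> irrelevant_ideal"
  unfolding irrelevant_ideal_def ideal_generated_def
  by (simp_all add: module_times module.span_base module.span_zero module.span_add module.span_diff
      module.span_neg module.span_scale mult.commute[of p q])

lemma mat_image_in_irrelevant_ideal:
  "w \<in> mat_image (d1 :: 'k::field A mat) \<Longrightarrow> p < 1 \<Longrightarrow> w $ p \<in> irrelevant_ideal"
  "w \<in> mat_image (d2 :: 'k::field A mat) \<Longrightarrow> p < 5 \<Longrightarrow> w $ p \<in> irrelevant_ideal"
  "w \<in> mat_image (d3 :: 'k::field A mat) \<Longrightarrow> p < 6 \<Longrightarrow> w $ p \<in> irrelevant_ideal"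
  unfolding mat_image_def
  by (auto simp: less_numeral_cases d1_mult_vec d2_mult_vec d3_mult_vec
      simp del: index_mult_mat_vec One_nat_def)
    (simp_all add: in_variables irrelevant_ideal_closed power2_eq_square del: One_nat_def)

section \<open>Homogeneity of the entries\<close>

lemma mon_degree_add: "mon_degree (m + n) = mon_degree m + mon_degree n"
  unfolding mon_degree_def by (rule setsum_keys_plus_distrib) auto

lemma homogeneous_Var: "homogeneous 1 (Var t)"
  by (simp add: homogeneous_def Var_def mon_degree_def)

lemma homogeneous_zero: "homogeneous d 0"
  by (simp add: homogeneous_def)

lemma homogeneous_add: "homogeneous d p \<Longrightarrow> homogeneous d q \<Longrightarrow> homogeneous d (p + q)"
  unfolding homogeneous_def using keys_add[of p q] by auto

lemma homogeneous_uminus: "homogeneous d p \<Longrightarrow> homogeneous d (- p)"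
  by (simp add: homogeneous_def in_keys_iff)

lemma homogeneous_diff: "homogeneous d p \<Longrightarrow> homogeneous d q \<Longrightarrow> homogeneous d (p - q)"
  using homogeneous_add[of d p "- q"] homogeneous_uminus[of d q] by simp

lemma homogeneous_mult:
  assumes "homogeneous d p" "homogeneous e q"
  shows "homogeneous (d + e) (p * q)"
  unfolding homogeneous_def
proof
  fix m assume "m \<in> Poly_Mapping.keys (p * q)"
  then obtain a b where "m = a + b" "a \<in> Poly_Mapping.keys p" "b \<in> Poly_Mapping.keys q"
    using keys_mult[of p q] by blast
  then show "int (mon_degree m) = d + e"
    using assms by (simp add: homogeneous_def mon_degree_add)
qed

lemma homogeneous_constant: "homogeneous 0 (Poly_Mapping.single 0 c)"
  by (simp add: homogeneous_def mon_degree_def)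

lemma homogeneous_numeral: "homogeneous 0 (numeral n)"
  using homogeneous_constant[of "numeral n"] by simp

lemma homogeneous_mult_numeral:
  "homogeneous d p \<Longrightarrow> homogeneous d (numeral n * p)"
  "homogeneous d p \<Longrightarrow> homogeneous d (- numeral n * p)"
  using homogeneous_mult[OF homogeneous_numeral[of n], of d p]
    homogeneous_mult[OF homogeneous_uminus[OF homogeneous_numeral[of n]], of d p] by simp_all

text \<open>The products of nonconstant factors that occur have degrees 1 + 1, 1 + 2 and 2 +
  2.\<close>

lemmas homogeneous_rules =
  homogeneous_Var homogeneous_zero homogeneous_add homogeneous_uminus homogeneous_diff
  homogeneous_mult_numeral
  homogeneous_mult[of 1 _ 1, simplified] homogeneous_mult[of 1 _ 2, simplified]
  homogeneous_mult[of 2 _ 2, simplified]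

lemma homogeneous_x_el: "homogeneous 1 (x_el i j)" and homogeneous_y_el: "homogeneous 1 (y_el i j)"
  by (simp_all add: x_el_def x_up_def y_el_def y_up_def homogeneous_rules)

lemma homogeneous_z:
  "homogeneous 1 z123" "homogeneous 1 z124" "homogeneous 1 z134" "homogeneous 1 z234"
  by (simp_all add: z123_def z124_def z134_def z234_def homogeneous_Var)

lemma homogeneous_Delta: "homogeneous 2 (Delta (i, j) (k, l))"
  by (simp add: Delta_eq homogeneous_rules homogeneous_x_el homogeneous_y_el)

lemma homogeneous_quadratic:
  "homogeneous 2 delta1" "homogeneous 2 delta2" "homogeneous 2 delta3"
  "homogeneous 2 a_el" "homogeneous 2 b_el" "homogeneous 2 c_el"
  by (simp_all add: delta1_def delta2_def delta3_def a_el_def b_el_def c_el_def homogeneous_Delta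
      homogeneous_rules homogeneous_x_el homogeneous_y_el)

lemma homogeneous_u_v:
  "homogeneous 2 (u_el 1)" "homogeneous 2 (u_el 2)" "homogeneous 2 (u_el 3)" "homogeneous 2 (u_el 4)"
  "homogeneous 2 (v_el 1)" "homogeneous 2 (v_el 2)" "homogeneous 2 (v_el 3)" "homogeneous 2 (v_el 4)"
  unfolding u_el_eqs v_el_eqs by (simp_all add: homogeneous_rules)

lemma homogeneous_generators:
  "homogeneous 3 u123" "homogeneous 3 u124" "homogeneous 3 u134" "homogeneous 3 u234"
  "homogeneous 4 u_disc"
  by (simp_all add: u123_def u124_def u134_def u234_def u_disc_def power2_eq_square
      homogeneous_rules homogeneous_z homogeneous_Delta homogeneous_quadratic)

text \<open>The free modules are A, A(-3)^4 + A(-4), A(-5)^6 and A(-7)^2: four cubic generators and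
  a quartic one, then syzygies in degree 5, then entries of \<open>d3\<close> that are all
  quadratic.\<close>

definition basis_degree :: "nat \<Rightarrow> nat \<Rightarrow> int" where
  "basis_degree i q = [0, if q < 4 then 3 else 4, 5, 7] ! i"

lemma homogeneous_entries:
  "p < 1 \<Longrightarrow> q < 5 \<Longrightarrow> homogeneous (basis_degree 1 q - basis_degree 0 p) (d1 $$ (p, q))"
  "p < 5 \<Longrightarrow> q < 6 \<Longrightarrow> homogeneous (basis_degree 2 q - basis_degree 1 p) (d2 $$ (p, q))"
  "p < 6 \<Longrightarrow> q < 2 \<Longrightarrow> homogeneous (basis_degree 3 q - basis_degree 2 p) (d3 $$ (p, q))"
  by (auto simp: less_numeral_cases d1_def d2_def d3_def mat_of_rows_list_index basis_degree_def
      homogeneous_rules homogeneous_z homogeneous_Delta homogeneous_quadratic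
      homogeneous_u_v[simplified] homogeneous_generators)

lemma graded_complex_d: "graded_complex basis_degree [1, 5, 6, 2] [d1, d2, d3 :: 'k::field A mat]"
  unfolding graded_complex_def
proof (intro allI impI)
  fix i p q :: nat
  assume "i < length [d1, d2, d3 :: 'k A mat]" "p < [1, 5, 6, 2] ! i" "q < [1, 5, 6, 2] ! Suc i"
  moreover from this(1) have "i = 0 \<or> i = 1 \<or> i = 2"
    by auto
  ultimately show "homogeneous (basis_degree (Suc i) q - basis_degree i p)
      ([d1, d2, d3 :: 'k A mat] ! i $$ (p, q))"
    using homogeneous_entries[of p q] by (auto simp: numeral_2_eq_2 numeral_3_eq_3)
qed

lemma minimal_complex_d: "minimal_complex [1, 5, 6, 2] [d1, d2, d3 :: 'k::field A mat]"
  unfolding minimal_complex_def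
proof (intro allI impI ballI)
  fix i p :: nat and w :: "'k A vec"
  assume "i < length [d1, d2, d3 :: 'k A mat]" "w \<in> mat_image ([d1, d2, d3 :: 'k A mat] ! i)"
    "p < [1, 5, 6, 2] ! i"
  moreover from this(1) have "i = 0 \<or> i = 1 \<or> i = 2"
    by auto
  ultimately show "w $ p \<in> irrelevant_ideal"
    using mat_image_in_irrelevant_ideal by auto
qed

section \<open>The resolution\<close>

lemma mat_image_d1: "{w \<in> carrier_vec 1. w $ 0 \<in> J_ideal} = mat_image (d1 :: 'k::field A mat)"
proof (intro Set.set_eqI iffI)
  fix w :: "'k A vec"
  assume w: "w \<in> {w \<in> carrier_vec 1. w $ 0 \<in> J_ideal}"
  then obtain a b c d e where
    eq: "w $ 0 = u234 * a + u134 * b + u124 * c + u123 * d + u_disc * e"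
    by (auto simp: mem_J_ideal)
  let ?v = "vec 5 (\<lambda>i. [a, b, c, d, e] ! i)"
  have v: "?v \<in> carrier_vec 5"
    by simp
  have "(d1 *\<^sub>v ?v) $ 0 = w $ 0"
    by (simp add: d1_mult_vec eq del: index_mult_mat_vec)
  then have "w = d1 *\<^sub>v ?v"
    using w by (intro eq_vecI) (auto simp del: index_mult_mat_vec)
  then show "w \<in> mat_image d1"
    using v by (auto simp: mat_image_def)
next
  fix w :: "'k A vec"
  assume "w \<in> mat_image d1"
  then obtain v where v: "v \<in> carrier_vec 5" "w = d1 *\<^sub>v v"
    by (auto simp: mat_image_def)
  then have "w $ 0 = u234 * v $ 0 + u134 * v $ 1 + u124 * v $ 2 + u123 * v $ 3 + u_disc * v $ 4"
    by (simp add: d1_mult_vec del: index_mult_mat_vec)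
  moreover have "w \<in> carrier_vec 1"
    unfolding v(2) by (rule carrier_vecI) simp
  ultimately show "w \<in> {w \<in> carrier_vec 1. w $ 0 \<in> J_ideal}"
    unfolding mem_J_ideal by blast
qed

lemma mat_kernel_d1:
  assumes "(2 :: 'k::field) \<noteq> 0"
  shows "mat_kernel (d1 :: 'k A mat) = mat_image d2"
proof (intro Set.set_eqI iffI)
  fix w :: "'k A vec"
  assume "w \<in> mat_kernel d1"
  then show "w \<in> mat_image d2"
    using kernel_d1[OF assms, of w] by (auto simp: mat_kernel_def mat_image_def)
next
  fix w :: "'k A vec"
  assume "w \<in> mat_image d2"
  then obtain v where v: "v \<in> carrier_vec 6" "w = d2 *\<^sub>v v"
    by (auto simp: mat_image_def)
  then have "d1 *\<^sub>v w = 0\<^sub>v 1"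
    using d1_d2_mult_vec[of v] by simp
  moreover have "w \<in> carrier_vec 5"
    unfolding v(2) by (rule carrier_vecI) simp
  ultimately show "w \<in> mat_kernel d1"
    by (simp add: mat_kernel_def)
qed

lemma mat_kernel_d2:
  assumes "(2 :: 'k::field) \<noteq> 0"
  shows "mat_kernel (d2 :: 'k A mat) = mat_image d3"
proof (intro Set.set_eqI iffI)
  fix w :: "'k A vec"
  assume "w \<in> mat_kernel d2"
  then show "w \<in> mat_image d3"
    using kernel_d2[OF assms, of w] by (auto simp: mat_kernel_def mat_image_def)
next
  fix w :: "'k A vec"
  assume "w \<in> mat_image d3"
  then obtain v where v: "v \<in> carrier_vec 2" "w = d3 *\<^sub>v v"
    by (auto simp: mat_image_def)
  then have "d2 *\<^sub>v w = 0\<^sub>v 5"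
    using d2_d3_mult_vec[of v] by simp
  moreover have "w \<in> carrier_vec 6"
    unfolding v(2) by (rule carrier_vecI) simp
  ultimately show "w \<in> mat_kernel d2"
    by (simp add: mat_kernel_def)
qed

lemma mat_kernel_d3:
  assumes "(2 :: 'k::field) \<noteq> 0"
  shows "mat_kernel (d3 :: 'k A mat) = {0\<^sub>v 2}"
proof -
  have "d3 *\<^sub>v 0\<^sub>v 2 = (0\<^sub>v 6 :: 'k A vec)"
    by (intro eq_vecI) (simp_all add: scalar_prod_def)
  then show ?thesis
    using kernel_d3[OF assms] by (auto simp: mat_kernel_def)
qed

lemma free_resolution_quot_d:
  assumes "(2 :: 'k::field) \<noteq> 0"
  shows "free_resolution_quot (J_ideal :: 'k A set) [1, 5, 6, 2] [d1, d2, d3]"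
  unfolding free_resolution_quot_def
proof (intro conjI allI impI)
  show "{w \<in> carrier_vec 1. w $ 0 \<in> (J_ideal :: 'k A set)} = boundaries [1, 5, 6, 2] [d1, d2, d3] 0"
    by (simp add: boundaries_def mat_image_d1[simplified])
next
  fix i
  assume "i < length [d1, d2, d3 :: 'k A mat]"
  then have i: "i = 0 \<or> i = 1 \<or> i = 2"
    by auto
  then show "[d1, d2, d3 :: 'k A mat] ! i \<in> carrier_mat ([1, 5, 6, 2] ! i) ([1, 5, 6, 2] ! Suc i)"
    using carrier_mats(1-3) by auto
  \<comment> \<open>For \<open>i = 2\<close> the boundaries are by convention the zero module, so
    this case is injectivity of \<open>d3\<close>.\<close>
  show "mat_kernel ([d1, d2, d3 :: 'k A mat] ! i) = boundaries [1, 5, 6, 2] [d1, d2, d3] (Suc i)"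
    using i mat_kernel_d1[OF assms] mat_kernel_d2[OF assms] mat_kernel_d3[OF assms]
    by (auto simp: boundaries_def)
qed simp_all

theorem mainTheorem1:
  assumes "CHAR('k::field) \<noteq> 2"
  shows "minimal_graded_free_resolution_quot (J_ideal :: 'k A set) [1, 5, 6, 2] [d1, d2, d3]"
proof -
  have "(2 :: 'k) \<noteq> 0"
  proof
    assume "(2 :: 'k) = 0"
    then have "CHAR('k) dvd 2"
      by (simp flip: of_nat_eq_0_iff_char_dvd)
    \<comment> \<open>Characteristic 1 would mean 1 = 0, impossible in a field.\<close>
    then have "CHAR('k) = 1 \<or> CHAR('k) = 2"
      using two_is_prime_nat unfolding prime_nat_iff by blast
    then show False
      using assms by simp
  qed
  moreover have "basis_degree 0 0 = 0"
    by (simp add: basis_degree_def)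
  ultimately show ?thesis
    unfolding minimal_graded_free_resolution_quot_def
    using free_resolution_quot_d graded_complex_d minimal_complex_d by blast
qed

end
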